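(* There is an algorithm which, given a graph $G$ on $n$ vertices and a linear ordering of the vertices of $G$ with width $b$, computes a cube representation of $G$ in $b+1$ dimensions in $O(b\cdot n)$ time. In particular, given a bandwidth ordering of the vertices of $G$, a cube representation of $G$ in $bw+1$ dimensions is computed in $O(bw\cdot n)$ time, where $bw$ is the bandwidth of $G$.
   Context: All graphs are simple, finite and undirected. A linear ordering of a graph $G=(V,E)$ on $n$ vertices is a bijection $f:V\to\{1,\ldots,n\}$; its width is $\max_{(u,v)\in E}|f(u)-f(v)|$. The bandwidth of $G$ is the minimum possible width of a linear ordering of $G$, and a bandwidth ordering of $G$ is a linear ordering whose width equals the bandwidth of $G$. A $k$-cube is a Cartesian product $R_1\times\cdots\times R_k$ where each $R_i$ is a closed interval of the form $[a_i,a_i+1]$ on the real line. A cube representation of $G$ in $k$ dimensions is an assignment of a $k$-cube to each vertex of $G$ such that two distinct vertices are adjacent in $G$ if and only if their $k$-cubes have non-empty intersection. Equivalently, one may output $k$ maps $f_1,\ldots,f_k:V\to\mathbb{R}$ together with interval lengths $x_1,\ldots,x_k>0$ such that distinct $u,v$ are adjacent in $G$ if and only if $|f_i(u)-f_i(v)|\le x_i$ for all $1\le i\le k$ (rescaling coordinate $i$ by $1/x_i$ gives unit cubes). *)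

theory Defs
  imports Complex_Main "HOL-Library.FuncSet"
begin

section \<open>Graphs, linear orderings and bandwidth\<close>

definition simple_graph :: "'a set \<Rightarrow> 'a set set \<Rightarrow> bool" where
  "simple_graph V E \<longleftrightarrow> finite V \<and> E \<subseteq> {e. e \<subseteq> V \<and> card e = 2}"

definition linear_ordering :: "'a set \<Rightarrow> ('a \<Rightarrow> nat) \<Rightarrow> bool" where
  "linear_ordering V f \<longleftrightarrow> bij_betw f V {1..card V}"

text \<open>The inserted 0 only matters for edgeless graphs, where the maximum would range over
  the empty set; all other members of the set are non-negative.\<close>

definition width :: "'a set set \<Rightarrow> ('a \<Rightarrow> nat) \<Rightarrow> nat" where
  "width E f = Max (insert 0 {nat \<bar>int (f u) - int (f v)\<bar> | u v. {u, v} \<in> E})"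

definition bandwidth :: "'a set \<Rightarrow> 'a set set \<Rightarrow> nat" where
  "bandwidth V E = (LEAST w. \<exists>f. linear_ordering V f \<and> width E f = w)"

definition bandwidth_ordering :: "'a set \<Rightarrow> 'a set set \<Rightarrow> ('a \<Rightarrow> nat) \<Rightarrow> bool" where
  "bandwidth_ordering V E f \<longleftrightarrow> linear_ordering V f \<and> width E f = bandwidth V E"


section \<open>Cube representations\<close>

definition kcube :: "nat \<Rightarrow> (nat \<Rightarrow> real) \<Rightarrow> (nat \<Rightarrow> real) set" where
  "kcube k a = (\<Pi>\<^sub>E i\<in>{..<k}. {a i .. a i + 1})"

definition cube_representation ::
    "'a set \<Rightarrow> 'a set set \<Rightarrow> nat \<Rightarrow> ('a \<Rightarrow> (nat \<Rightarrow> real) set) \<Rightarrow> bool" where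
  "cube_representation V E k R \<longleftrightarrow>
     (\<forall>v\<in>V. \<exists>a. R v = kcube k a) \<and>
     (\<forall>u\<in>V. \<forall>v\<in>V. u \<noteq> v \<longrightarrow> ({u, v} \<in> E \<longleftrightarrow> R u \<inter> R v \<noteq> {}))"


section \<open>Algorithms: a word RAM\<close>

text \<open>Algorithms are programs of a structured random access machine with finitely many named
  registers and named arrays of unsigned words. A word holds a number of size at most W; an
  expression may only be evaluated if the values of all its subexpressions fit into a word,
  and execution gets stuck otherwise. Every operator, memory access, test and assignment
  costs one unit of time.\<close>

datatype aexp =
    Const nat
  | Reg string
  | Arr string aexp
  | Plus aexp aexp
  | Minus aexp aexp
  | Times aexp aexp

datatype bexp = Less aexp aexp | Equal aexp aexp

datatype com =
    Skip
  | SetReg string aexp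
  | SetArr string aexp aexp
  | Seq com com
  | If bexp com com
  | While bexp com

record state =
  reg :: "string \<Rightarrow> nat"
  arr :: "string \<Rightarrow> nat \<Rightarrow> nat"

fun aval :: "aexp \<Rightarrow> state \<Rightarrow> nat" where
  "aval (Const c) s = c"
| "aval (Reg x) s = reg s x"
| "aval (Arr a e) s = arr s a (aval e s)"
| "aval (Plus e1 e2) s = aval e1 s + aval e2 s"
| "aval (Minus e1 e2) s = aval e1 s - aval e2 s"
| "aval (Times e1 e2) s = aval e1 s * aval e2 s"

fun fits :: "nat \<Rightarrow> aexp \<Rightarrow> state \<Rightarrow> bool" where
  "fits W (Const c) s \<longleftrightarrow> c \<le> W"
| "fits W (Reg x) s \<longleftrightarrow> reg s x \<le> W"
| "fits W (Arr a e) s \<longleftrightarrow> fits W e s \<and> aval (Arr a e) s \<le> W"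
| "fits W (Plus e1 e2) s \<longleftrightarrow> fits W e1 s \<and> fits W e2 s \<and> aval (Plus e1 e2) s \<le> W"
| "fits W (Minus e1 e2) s \<longleftrightarrow> fits W e1 s \<and> fits W e2 s \<and> aval (Minus e1 e2) s \<le> W"
| "fits W (Times e1 e2) s \<longleftrightarrow> fits W e1 s \<and> fits W e2 s \<and> aval (Times e1 e2) s \<le> W"

fun acost :: "aexp \<Rightarrow> nat" where
  "acost (Const c) = 1"
| "acost (Reg x) = 1"
| "acost (Arr a e) = 1 + acost e"
| "acost (Plus e1 e2) = 1 + acost e1 + acost e2"
| "acost (Minus e1 e2) = 1 + acost e1 + acost e2"
| "acost (Times e1 e2) = 1 + acost e1 + acost e2"

fun bval :: "bexp \<Rightarrow> state \<Rightarrow> bool" where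
  "bval (Less e1 e2) s \<longleftrightarrow> aval e1 s < aval e2 s"
| "bval (Equal e1 e2) s \<longleftrightarrow> aval e1 s = aval e2 s"

fun bfits :: "nat \<Rightarrow> bexp \<Rightarrow> state \<Rightarrow> bool" where
  "bfits W (Less e1 e2) s \<longleftrightarrow> fits W e1 s \<and> fits W e2 s"
| "bfits W (Equal e1 e2) s \<longleftrightarrow> fits W e1 s \<and> fits W e2 s"

fun bcost :: "bexp \<Rightarrow> nat" where
  "bcost (Less e1 e2) = 1 + acost e1 + acost e2"
| "bcost (Equal e1 e2) = 1 + acost e1 + acost e2"

text \<open>\<open>exec W p s t s'\<close>: with words bounded by W, the program p started in s halts in s'
  after exactly t units of time.\<close>

inductive exec :: "nat \<Rightarrow> com \<Rightarrow> state \<Rightarrow> nat \<Rightarrow> state \<Rightarrow> bool" for W :: nat where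
  Skip: "exec W Skip s 1 s"
| SetReg: "fits W e s \<Longrightarrow>
    exec W (SetReg x e) s (1 + acost e) (s\<lparr>reg := (reg s)(x := aval e s)\<rparr>)"
| SetArr: "fits W i s \<Longrightarrow> fits W e s \<Longrightarrow>
    exec W (SetArr a i e) s (1 + acost i + acost e)
      (s\<lparr>arr := (arr s)(a := (arr s a)(aval i s := aval e s))\<rparr>)"
| Seq: "exec W p s t s' \<Longrightarrow> exec W q s' t' s'' \<Longrightarrow> exec W (Seq p q) s (t + t') s''"
| IfTrue: "bfits W c s \<Longrightarrow> bval c s \<Longrightarrow> exec W p s t s' \<Longrightarrow>
    exec W (If c p q) s (bcost c + t) s'"
| IfFalse: "bfits W c s \<Longrightarrow> \<not> bval c s \<Longrightarrow> exec W q s t s' \<Longrightarrow>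
    exec W (If c p q) s (bcost c + t) s'"
| WhileFalse: "bfits W c s \<Longrightarrow> \<not> bval c s \<Longrightarrow> exec W (While c p) s (bcost c) s"
| WhileTrue: "bfits W c s \<Longrightarrow> bval c s \<Longrightarrow> exec W p s t s' \<Longrightarrow>
    exec W (While c p) s' t' s'' \<Longrightarrow> exec W (While c p) s (bcost c + t + t') s''"

inductive_cases exec_elims:
  "exec W Skip s t s'"
  "exec W (SetReg x e) s t s'"
  "exec W (SetArr a i e) s t s'"
  "exec W (Seq p q) s t s'"
  "exec W (If c p q) s t s'"
  "exec W (While c p) s t s'"

lemma exec_deterministic:
  assumes "exec W p s t s'" and "exec W p s u r"
  shows "t = u \<and> s' = r"
  using assms
proof (induction arbitrary: u r rule: exec.induct)
  case (Seq p s t s' q t' s'')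
  then show ?case by (blast elim: exec_elims(4))
next
  case (IfTrue c s p t s' q)
  then show ?case by (blast elim: exec_elims(5))
next
  case (IfFalse c s q t s' p)
  then show ?case by (blast elim: exec_elims(5))
next
  case (WhileFalse c s p)
  then show ?case by (blast elim: exec_elims(6))
next
  case (WhileTrue c s p t s' t' s'')
  from WhileTrue.prems WhileTrue.hyps obtain t1 s1 t2
    where "exec W p s t1 s1" "exec W (While c p) s1 t2 r" "u = bcost c + t1 + t2"
    by (blast elim: exec_elims(6))
  with WhileTrue.IH show ?case by blast
qed (auto elim: exec_elims)


section \<open>Input and output\<close>

text \<open>A graph is presented by a numbering vs of its vertices by 0, ..., n - 1 and, for each
  vertex number, the list of the numbers of its neighbours in arbitrary order.\<close>

definition adjacency_lists :: "'a set \<Rightarrow> 'a set set \<Rightarrow> 'a list \<Rightarrow> nat list list \<Rightarrow> bool" where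
  "adjacency_lists V E vs L \<longleftrightarrow>
     distinct vs \<and> set vs = V \<and> length L = length vs \<and>
     (\<forall>i<length vs. distinct (L ! i) \<and>
        set (L ! i) = {j. j < length vs \<and> {vs ! i, vs ! j} \<in> E})"

definition array_of :: "nat list \<Rightarrow> nat \<Rightarrow> nat" where
  "array_of xs i = (if i < length xs then xs ! i else 0)"

text \<open>The adjacency lists are stored one after the other in \<open>adj\<close>: the list of vertex i
  occupies the cells from \<open>off[i]\<close> (inclusive) to \<open>off[i + 1]\<close> (exclusive). The array \<open>pos\<close>
  holds the linear ordering. All other memory is initially 0; in particular the width of
  the ordering is not part of the input.\<close>

definition input_state :: "'a list \<Rightarrow> nat list list \<Rightarrow> ('a \<Rightarrow> nat) \<Rightarrow> state" where
  "input_state vs L f =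
     \<lparr>reg = (\<lambda>_. 0)(''n'' := length vs),
      arr = (\<lambda>_ _. 0)
        (''off'' := array_of (map (\<lambda>i. length (concat (take i L))) [0..<length L + 1]),
         ''adj'' := array_of (concat L),
         ''pos'' := array_of (map f vs))\<rparr>"

text \<open>The output consists of the dimension k, interval lengths \<open>len[0], ..., len[k - 1]\<close>, and
  for the vertex with number i the k consecutive entries of \<open>coord\<close> starting at i * k.
  Dividing coordinate j by \<open>len[j]\<close> turns these into the corners of unit cubes.\<close>

definition outputs_cubes ::
    "state \<Rightarrow> 'a list \<Rightarrow> nat \<Rightarrow> ('a \<Rightarrow> (nat \<Rightarrow> real) set) \<Rightarrow> bool" where
  "outputs_cubes s vs k R \<longleftrightarrow>
     reg s ''k'' = k \<and> (\<forall>j<k. arr s ''len'' j > 0) \<and>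
     (\<forall>i<length vs. R (vs ! i) =
        kcube k (\<lambda>j. real (arr s ''coord'' (i * k + j)) / real (arr s ''len'' j)))"

definition computes_cube_representation ::
    "nat \<Rightarrow> com \<Rightarrow> 'a set \<Rightarrow> 'a set set \<Rightarrow> ('a \<Rightarrow> nat) \<Rightarrow> nat \<Rightarrow> nat \<Rightarrow> bool" where
  "computes_cube_representation W p V E f k T \<longleftrightarrow>
     (\<forall>vs L. adjacency_lists V E vs L \<longrightarrow>
        (\<exists>t s R. exec W p (input_state vs L f) t s \<and> t \<le> T \<and>
           outputs_cubes s vs k R \<and> cube_representation V E k R))"

text \<open>On a graph with n vertices the machine has words of O(log n) bits, that is, words
  bounded by a fixed polynomial in n.\<close>

definition word_bound :: "nat \<Rightarrow> nat \<Rightarrow> nat" where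
  "word_bound d n = (n + 2) ^ d"

text \<open>If the width b is positive, then n is at least 2 and this is b * n. A machine that has to
  write n corners cannot meet the bound b * n = 0 when b = 0, and it cannot halt in no time
  when n = 0; for these degenerate inputs a zero factor is read as 1.\<close>

definition time_scale :: "nat \<Rightarrow> nat \<Rightarrow> nat" where
  "time_scale b n = max 1 b * max 1 n"

end

theory Submission
  imports Defs
begin

text \<open>Let the vertices occupy the positions 1, ..., n, and let \<open>b\<close> be the width. Two adjacent
  positions differ by at most \<open>b\<close>. One coordinate, essentially a large multiple of the position,
  separates all pairs of distance more than \<open>b\<close>, and a small correction that accumulates along
  each residue class modulo \<open>b\<close> makes it also decide the pairs of distance exactly \<open>b\<close>. A
  non-adjacent pair \<open>p < q < p + b\<close> is separated by the coordinate belonging to the residue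
  class of \<open>p\<close> modulo \<open>b\<close>. On a word RAM, two scans over the adjacency lists yield the width
  and a table of the adjacencies within the band of \<open>b\<close> diagonals. Since all other memory is
  initially 0, the table need not be initialised, and each coordinate is then computed in
  constant time.\<close>

section \<open>Weakest preconditions with time\<close>

text \<open>For one residue class, cut the positions into blocks of \<open>b\<close> consecutive
  ones, each headed by a member of the class. With interval length 2, the head of block
  \<open>k\<close> gets \<open>k\<close> and the others \<open>k + 2\<close> or
  \<open>k + 3\<close>. Among pairs at distance at most \<open>b\<close>, this can refuse only a
  head and a later member of its own block. Each position heads a block in exactly one class, so
  \<open>b\<close> such coordinates deal with all distances below \<open>b\<close>. The obstacle is
  distance exactly \<open>b\<close>: such a pair heads consecutive blocks in its own class and stays
  within 2 in every short coordinate. The long coordinate must therefore accept some of these pairs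
  and refuse others with a single threshold. This works because the increments along
  \<open>p\<close>, \<open>p + b\<close>, \<open>p + 2 * b\<close>, ... can be chosen one at a time:
  0 for an edge and 2 for a nonedge, against a slack of 1. The accumulated correction is at most
  \<open>2 * n\<close>, which explains the multiplier \<open>2 * n + 3\<close>.\<close>

definition wp :: "nat \<Rightarrow> com \<Rightarrow> (nat \<Rightarrow> state \<Rightarrow> bool) \<Rightarrow> state \<Rightarrow> bool" where
  "wp W p Q s \<longleftrightarrow> (\<exists>t s'. exec W p s t s' \<and> Q t s')"

lemma wp_mono: "wp W p Q s \<Longrightarrow> (\<And>t s'. Q t s' \<Longrightarrow> Q' t s') \<Longrightarrow> wp W p Q' s"
  unfolding wp_def by blast

lemma wp_Skip: "Q 1 s \<Longrightarrow> wp W Skip Q s"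
  unfolding wp_def by (blast intro: exec.Skip)

lemma wp_SetReg:
  "fits W e s \<Longrightarrow> Q (1 + acost e) (s\<lparr>reg := (reg s)(x := aval e s)\<rparr>) \<Longrightarrow> wp W (SetReg x e) Q s"
  unfolding wp_def by (blast intro: exec.SetReg)

lemma wp_SetArr:
  "fits W i s \<Longrightarrow> fits W e s \<Longrightarrow>
   Q (1 + acost i + acost e) (s\<lparr>arr := (arr s)(a := (arr s a)(aval i s := aval e s))\<rparr>) \<Longrightarrow>
   wp W (SetArr a i e) Q s"
  unfolding wp_def by (blast intro: exec.SetArr)

text \<open>The postcondition takes the elapsed time as an argument, so composition merely adds
  times, and correctness and cost are proved together.\<close>

lemma wp_Seq: "wp W p (\<lambda>t. wp W q (\<lambda>t'. Q (t + t'))) s \<Longrightarrow> wp W (Seq p q) Q s"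
  unfolding wp_def by (blast intro: exec.Seq)

lemma wp_If:
  assumes "bfits W c s"
    and "bval c s \<Longrightarrow> wp W p (\<lambda>t. Q (bcost c + t)) s"
    and "\<not> bval c s \<Longrightarrow> wp W q (\<lambda>t. Q (bcost c + t)) s"
  shows "wp W (If c p q) Q s"
  using assms unfolding wp_def by (cases "bval c s") (blast intro: exec.IfTrue exec.IfFalse)+

text \<open>The potential \<open>\<mu>\<close> bounds the remaining running time, so it also witnesses termination.\<close>

lemma wp_While:
  assumes "I s"
    and fits: "\<And>s. I s \<Longrightarrow> bfits W c s"
    and step: "\<And>s. I s \<Longrightarrow> bval c s \<Longrightarrow>
      wp W p (\<lambda>t s'. I s' \<and> bcost c + t + \<mu> s' \<le> \<mu> s) s"
    and stop: "\<And>s. I s \<Longrightarrow> \<not> bval c s \<Longrightarrow> bcost c \<le> \<mu> s"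
    and Q: "\<And>t s'. I s' \<Longrightarrow> \<not> bval c s' \<Longrightarrow> t \<le> \<mu> s \<Longrightarrow> Q t s'"
  shows "wp W (While c p) Q s"
proof -
  have "\<exists>t s'. exec W (While c p) s t s' \<and> t \<le> \<mu> s \<and> I s' \<and> \<not> bval c s'"
    using \<open>I s\<close>
  proof (induction "\<mu> s" arbitrary: s rule: less_induct)
    case less
    show ?case
    proof (cases "bval c s")
      case True
      from step[OF less.prems True] obtain t s1
        where s1: "exec W p s t s1" "I s1" "bcost c + t + \<mu> s1 \<le> \<mu> s"
        unfolding wp_def by blast
      have "0 < bcost c" by (cases c) auto
      with s1 have "\<mu> s1 < \<mu> s" by simp
      from less.hyps[OF this s1(2)] obtain t' s'
        where "exec W (While c p) s1 t' s'" "t' \<le> \<mu> s1" "I s'" "\<not> bval c s'" by blast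
      moreover from this(1) have "exec W (While c p) s (bcost c + t + t') s'"
        using exec.WhileTrue fits[OF less.prems] True s1(1) by blast
      moreover have "bcost c + t + t' \<le> \<mu> s" using s1(3) calculation(2) by linarith
      ultimately show ?thesis by blast
    next
      case False
      then show ?thesis using exec.WhileFalse fits[OF less.prems] stop less.prems by blast
    qed
  qed
  with Q show ?thesis unfolding wp_def by blast
qed


section \<open>The coordinates\<close>

lemma kcube_Int_nonempty_iff:
  "kcube k a \<inter> kcube k a' \<noteq> {} \<longleftrightarrow> (\<forall>j<k. \<bar>a j - a' j\<bar> \<le> 1)"
proof
  assume "kcube k a \<inter> kcube k a' \<noteq> {}"
  then obtain x where x: "x \<in> kcube k a" "x \<in> kcube k a'" by blast
  show "\<forall>j<k. \<bar>a j - a' j\<bar> \<le> 1"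
  proof (intro allI impI)
    fix j assume "j < k"
    then have "x j \<in> {a j..a j + 1}" "x j \<in> {a' j..a' j + 1}"
      using x unfolding kcube_def by (blast dest: PiE_mem)+
    then show "\<bar>a j - a' j\<bar> \<le> 1" unfolding atLeastAtMost_iff by linarith
  qed
next
  assume close: "\<forall>j<k. \<bar>a j - a' j\<bar> \<le> 1"
  \<comment> \<open>The larger left end is the least point that can lie in both intervals.
    Restricting to the index set makes \<open>x\<close> extensional, as \<open>PiE\<close>
    demands.\<close>
  define x where "x = (\<lambda>j\<in>{..<k}. max (a j) (a' j))"
  have x: "x j \<in> {a j..a j + 1} \<inter> {a' j..a' j + 1}" if "j < k" for j
  proof -
    from that have "x j = max (a j) (a' j)" by (simp add: x_def)
    then show ?thesis using close[rule_format, OF that]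
      unfolding Int_iff atLeastAtMost_iff by linarith
  qed
  have "x \<in> extensional {..<k}" by (simp add: x_def)
  then have "x \<in> kcube k a \<inter> kcube k a'"
    unfolding kcube_def PiE_def Pi_def using x by blast
  then show "kcube k a \<inter> kcube k a' \<noteq> {}" by blast
qed

text \<open>Two sums instead of an absolute difference keep the later reasoning within the natural
  numbers and clear of truncated subtraction.\<close>

lemma abs_diff_le_1_iff:
  fixes x y l :: nat
  assumes "0 < l"
  shows "\<bar>real x / real l - real y / real l\<bar> \<le> 1 \<longleftrightarrow> x \<le> y + l \<and> y \<le> x + l"
proof -
  have "\<bar>real x / real l - real y / real l\<bar> = \<bar>real x - real y\<bar> / real l"
    by (simp add: diff_divide_distrib[symmetric])
  also have "\<dots> \<le> 1 \<longleftrightarrow> \<bar>real x - real y\<bar> \<le> real l"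
    using assms by (simp add: divide_le_eq)
  also have "\<dots> \<longleftrightarrow> x \<le> y + l \<and> y \<le> x + l" by linarith
  finally show ?thesis .
qed

text \<open>The graph is moved to the positions. By symmetry, the one-sided \<open>nb_width\<close>
  bounds both differences. \<open>width_attained\<close> makes \<open>b\<close> the exact width
  rather than an upper bound, which is what lets the program recover \<open>b\<close> from its
  input.\<close>

locale band =
  fixes n b :: nat and nb :: "nat \<Rightarrow> nat \<Rightarrow> bool"
  assumes nb_range: "nb p q \<Longrightarrow> p \<in> {1..n} \<and> q \<in> {1..n}"
    and nb_sym: "nb p q \<Longrightarrow> nb q p"
    and nb_width: "nb p q \<Longrightarrow> p \<le> q + b"
    and width_attained: "b = 0 \<or> (\<exists>p. nb (p + b) p)"
begin

lemma b_le_n: "b \<le> n"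
  using width_attained nb_range by fastforce

text \<open>The 3 at \<open>t = 0\<close> marks the head of a block: it turns \<open>k + 3\<close>
  into \<open>k\<close>. For positive \<open>t \<ge> p\<close> the difference \<open>p - t\<close>
  is 0, which is no position, so the entry is 0.\<close>

definition band_entry :: "nat \<Rightarrow> nat \<Rightarrow> nat" where
  "band_entry p t = (if t = 0 then 3 else if nb p (p - t) then 1 else 0)"

text \<open>For every residue \<open>c < b\<close> the position \<open>p\<close> is written as \<open>p + b = c + k * b + t\<close> with
  \<open>t < b\<close>. The positions with \<open>t = 0\<close> get the value \<open>k\<close>; the others get \<open>k + 2\<close> or \<open>k + 3\<close>,
  depending on whether they are adjacent to the preceding position with \<open>t = 0\<close>.\<close>

definition short_coord :: "nat \<Rightarrow> nat \<Rightarrow> nat" where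
  "short_coord p c =
     (if p mod b < c then p div b + 3 - band_entry p (p mod b + b - c)
      else p div b + 4 - band_entry p (p mod b - c))"

text \<open>For \<open>0 < p \<le> b\<close> the predecessor is 0, which is no position, so it
  counts as nonadjacent and contributes 2. The test on \<open>b\<close> is what makes the recursion
  decrease.\<close>

fun shift :: "nat \<Rightarrow> nat" where
  "shift p = (if p = 0 \<or> b = 0 then 0 else shift (p - b) + (2 - 2 * band_entry p b))"

declare shift.simps[simp del]

text \<open>In this last coordinate the shifts are too small to matter unless two positions have
  distance exactly \<open>b\<close>.\<close>

definition long_coord :: "nat \<Rightarrow> nat" where
  "long_coord p = (2 * n + 3) * p + shift p"

definition coord :: "nat \<Rightarrow> nat \<Rightarrow> nat" where
  "coord p c = (if c < b then short_coord p c else long_coord p)"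

text \<open>The increments of \<open>shift\<close> are 0 or 2; the final 1 falls strictly between
  them.\<close>

definition len :: "nat \<Rightarrow> nat" where
  "len c = (if c < b then 2 else (2 * n + 3) * b + 1)"

section \<open>Which pairs of positions a coordinate separates\<close>

lemma shift_le: "shift p \<le> 2 * p"
proof (induction p rule: less_induct)
  case (less p)
  show ?case
  proof (cases "p = 0 \<or> b = 0")
    case False
    then have "shift (p - b) \<le> 2 * (p - b)" using less by simp
    moreover have "2 * (p - b) + 2 \<le> 2 * p" using False by linarith
    ultimately show ?thesis using False by (subst shift.simps) simp
  qed (simp add: shift.simps)
qed

text \<open>Working with \<open>p + b\<close> keeps \<open>k\<close> nonnegative when
  \<open>p < c\<close>. The branches of \<open>short_coord\<close> record whether
  \<open>c + t\<close> carries past \<open>b\<close>: without a carry \<open>p div b\<close> is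
  \<open>k - 1\<close>, with a carry it is \<open>k\<close>.\<close>

lemma short_coord_decomposition:
  assumes "p + b = c + k * b + t" "t < b" "c < b"
  shows "short_coord p c = k + 3 - band_entry p t"
proof (cases "c + t < b")
  case True
  show ?thesis
  proof (cases k)
    case 0
    then show ?thesis using assms True by simp
  next
    case (Suc k')
    then have p: "p = (c + t) + k' * b" using assms by simp
    then have "p div b = k'" "p mod b = c + t" using True by simp_all
    then show ?thesis using Suc by (simp add: short_coord_def)
  qed
next
  case False
  define r where "r = c + t - b"
  then have p: "p = r + k * b" "r < b" using assms False by simp_all
  then have "p div b = k" "p mod b = r" by simp_all
  moreover have "r < c" "r + b - c = t" using r_def False assms by simp_all
  ultimately show ?thesis by (simp add: short_coord_def)
qed

lemma position_decomposition:
  assumes "c < b"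
  obtains k t where "p + b = c + k * b + t" "t < b"
proof
  show "p + b = c + ((p + b - c) div b) * b + (p + b - c) mod b"
    using assms by simp
  show "(p + b - c) mod b < b" using assms by simp
qed

text \<open>As \<open>q \<le> p + b\<close>, the block of \<open>q\<close> is that of
  \<open>p\<close> or the next one. Only the head of a block against a later nonhead could exceed
  the interval length 2, and the two cases rule this out.\<close>

lemma short_coord_close:
  assumes "nb q p" "p < q" "c < b"
  shows "short_coord p c \<le> short_coord q c + 2 \<and> short_coord q c \<le> short_coord p c + 2"
proof -
  obtain k t where p: "p + b = c + k * b + t" "t < b" using position_decomposition \<open>c < b\<close> .
  obtain k' t' where q: "q + b = c + k' * b + t'" "t' < b" using position_decomposition \<open>c < b\<close> .
  have vp: "short_coord p c = k + 3 - band_entry p t"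
    and vq: "short_coord q c = k' + 3 - band_entry q t'"
    using short_coord_decomposition p q \<open>c < b\<close> by blast+
  have "q \<le> p + b" using nb_width assms by blast
  have "k \<le> k'"
  proof (rule ccontr)
    assume "\<not> k \<le> k'"
    then have "Suc k' * b \<le> k * b" by (intro mult_le_mono) auto
    then show False using p q \<open>p < q\<close> by simp
  qed
  moreover have "k' \<le> Suc k"
  proof (rule ccontr)
    assume "\<not> k' \<le> Suc k"
    then have "Suc (Suc k) * b \<le> k' * b" by (intro mult_le_mono) auto
    then show False using p q \<open>q \<le> p + b\<close> by simp
  qed
  ultimately consider "k' = k" | "k' = Suc k" by linarith
  then show ?thesis
  proof cases
    \<comment> \<open>Same block: \<open>q\<close> comes later, so \<open>t' > 0\<close>. If
      \<open>p\<close> is the head, then \<open>t' = q - p\<close>, and the edge itself makes the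
      entry of \<open>q\<close> equal to 1, which gives \<open>k\<close> against
      \<open>k + 2\<close>.\<close>
    case 1
    then have "t' = q - p + t" using p q \<open>p < q\<close> by simp
    then have "band_entry q t' \<le> 1" "t = 0 \<Longrightarrow> band_entry q t' = 1"
      and "band_entry p t \<le> 1 \<or> band_entry p t = 3 \<and> t = 0"
      using assms by (auto simp: band_entry_def)
    then show ?thesis using 1 vp vq by linarith
  next
    \<comment> \<open>Next block: \<open>t' \<le> t\<close>, so \<open>p\<close> can be a head only
      if \<open>q\<close> is one too. This excludes \<open>k\<close> against \<open>k + 3\<close> or
      \<open>k + 4\<close>.\<close>
    case 2
    then have "t' \<le> t" using p q \<open>q \<le> p + b\<close> by simp
    moreover have "t' \<noteq> 0 \<and> band_entry q t' \<le> 1 \<or> band_entry q t' = 3 \<and> t' = 0"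
      and "band_entry p t \<le> 1 \<or> band_entry p t = 3 \<and> t = 0"
      by (auto simp: band_entry_def)
    ultimately show ?thesis using 2 vp vq by linarith
  qed
qed

text \<open>In its own class \<open>p\<close> heads a block, with value \<open>k\<close>, and
  \<open>q\<close> lies in that block. Without an edge \<open>q\<close> gets \<open>k + 3\<close>,
  one more than the interval length allows.\<close>

lemma short_coord_far:
  assumes "\<not> nb q p" "p < q" "q < p + b"
  shows "short_coord p (p mod b) + 2 < short_coord q (p mod b)"
proof -
  have b: "p mod b < b" using assms by simp
  have p: "p + b = p mod b + Suc (p div b) * b + 0" by simp
  have q: "q + b = p mod b + Suc (p div b) * b + (q - p)" using p assms by linarith
  show ?thesis
    using short_coord_decomposition[OF p _ b] short_coord_decomposition[OF q _ b] assms
    by (simp add: band_entry_def)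
qed

text \<open>The shifts are at most \<open>2 * n\<close>. Hence below distance \<open>b\<close> the
  gap is less than \<open>(2 * n + 3) * b\<close>, and above it at least
  \<open>(2 * n + 3) * b + 3\<close>. At distance exactly \<open>b\<close> it is
  \<open>(2 * n + 3) * b\<close> plus the last increment of \<open>shift\<close>.\<close>

lemma long_coord_iff:
  assumes "p < q" "q \<le> n" "0 < p"
  shows "long_coord p \<le> long_coord q"
    and "long_coord q \<le> long_coord p + len b \<longleftrightarrow> q < p + b \<or> q = p + b \<and> nb q p"
proof -
  let ?N = "2 * n + 3"
  have sp: "shift p \<le> 2 * n" and sq: "shift q \<le> 2 * n"
    using shift_le[of p] shift_le[of q] assms by linarith+
  have "?N * (p + 1) \<le> ?N * q" using assms by (intro mult_le_mono) auto
  then show "long_coord p \<le> long_coord q"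
    using sp by (simp add: long_coord_def)
  consider "q < p + b" | "q = p + b" | "p + b < q" by linarith
  then show "long_coord q \<le> long_coord p + len b \<longleftrightarrow> q < p + b \<or> q = p + b \<and> nb q p"
  proof cases
    case 1
    then have "?N * (q + 1) \<le> ?N * (p + b)" by (intro mult_le_mono) auto
    then show ?thesis using sq 1 by (simp add: long_coord_def len_def add_mult_distrib2)
  next
    case 2
    then have "shift q = shift p + (2 - 2 * band_entry q b)"
      using assms by (subst shift.simps) simp
    then show ?thesis using 2 assms
      by (auto simp: long_coord_def len_def add_mult_distrib2 band_entry_def)
  next
    case 3
    then have "?N * (p + b + 1) \<le> ?N * q" by (intro mult_le_mono) auto
    then show ?thesis using sp 3 by (simp add: long_coord_def len_def add_mult_distrib2)
  qed
qed

text \<open>Every coordinate accepts every edge, so a nonedge needs just one that refuses it: the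
  long one from distance \<open>b\<close> on, otherwise the short one for the class of the earlier
  position.\<close>

lemma nb_iff_coord:
  assumes "p < q" "q \<le> n" "0 < p"
  shows "nb q p \<longleftrightarrow>
    (\<forall>c<b + 1. coord p c \<le> coord q c + len c \<and> coord q c \<le> coord p c + len c)"
    (is "_ \<longleftrightarrow> ?R")
proof
  assume nb: "nb q p"
  then have "q < p + b \<or> q = p + b \<and> nb q p" using nb_width[OF nb] by linarith
  then have long: "long_coord q \<le> long_coord p + len b" "long_coord p \<le> long_coord q"
    using long_coord_iff assms by blast+
  show ?R
  proof (intro allI impI)
    fix c assume "c < b + 1"
    show "coord p c \<le> coord q c + len c \<and> coord q c \<le> coord p c + len c"
    proof (cases "c < b")
      case True
      then show ?thesis using short_coord_close nb assms by (simp add: coord_def len_def)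
    next
      case False
      then have "c = b" using \<open>c < b + 1\<close> by simp
      then show ?thesis using long by (simp add: coord_def)
    qed
  qed
next
  assume R: ?R
  show "nb q p"
  proof (rule ccontr)
    assume "\<not> nb q p"
    have "long_coord q \<le> long_coord p + len b"
      using R[rule_format, of b] by (simp add: coord_def)
    then have "q < p + b" using long_coord_iff assms \<open>\<not> nb q p\<close> by blast
    \<comment> \<open>Together with \<open>p < q\<close> this excludes \<open>b = 0\<close>, where
      \<open>p mod b\<close> would be \<open>p\<close>.\<close>
    moreover from this have b: "p mod b < b" using assms by simp
    then have "p mod b < b + 1" by linarith
    from R[rule_format, OF this] b have "short_coord q (p mod b) \<le> short_coord p (p mod b) + 2"
      by (simp add: coord_def len_def)
    ultimately show False
      using short_coord_far[OF \<open>\<not> nb q p\<close>] assms by (meson not_le)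
  qed
qed

lemma len_pos: "0 < len c"
  by (simp add: len_def)

definition cube :: "nat \<Rightarrow> (nat \<Rightarrow> real) set" where
  "cube p = kcube (b + 1) (\<lambda>c. real (coord p c) / real (len c))"

lemma nb_iff_cube:
  assumes "p \<in> {1..n}" "q \<in> {1..n}" "p \<noteq> q"
  shows "nb p q \<longleftrightarrow> cube p \<inter> cube q \<noteq> {}"
  using assms
proof (induction p q rule: linorder_wlog)
  case (le p q)
  then have "nb q p \<longleftrightarrow> cube p \<inter> cube q \<noteq> {}"
    unfolding cube_def kcube_Int_nonempty_iff abs_diff_le_1_iff[OF len_pos]
    by (intro nb_iff_coord) auto
  then show ?case using nb_sym by blast
next
  case (sym p q)
  then show ?case using nb_sym by (metis Int_commute)
qed

end


section \<open>The program\<close>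

text \<open>The cursor \<open>e\<close> is never reset: the lists are stored back to back, so each
  one starts where the previous one ended.\<close>

definition edge_scan :: "com \<Rightarrow> com \<Rightarrow> com" where
  "edge_scan pre body =
     Seq (SetReg ''i'' (Const 0))
    (Seq (SetReg ''e'' (Const 0))
    (While (Less (Reg ''i'') (Reg ''n''))
       (Seq pre
       (Seq (While (Less (Reg ''e'') (Arr ''off'' (Plus (Reg ''i'') (Const 1))))
              (Seq body (SetReg ''e'' (Plus (Reg ''e'') (Const 1)))))
            (SetReg ''i'' (Plus (Reg ''i'') (Const 1)))))))"

text \<open>Every edge is scanned in both directions, so truncated subtraction finds its length.\<close>

definition edge_length :: aexp where
  "edge_length = Minus (Arr ''pos'' (Reg ''i'')) (Arr ''pos'' (Arr ''adj'' (Reg ''e'')))"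

definition update_width :: com where
  "update_width = If (Less (Reg ''b'') edge_length) (SetReg ''b'' edge_length) Skip"

definition record_vertex :: com where
  "record_vertex = SetArr ''inv'' (Arr ''pos'' (Reg ''i'')) (Reg ''i'')"

text \<open>A table row has \<open>b + 1\<close> cells, and cell \<open>t\<close> of row
  \<open>p\<close> concerns \<open>p\<close> and \<open>p - t\<close>. From the end with the smaller
  position the truncated length is 0; this stray write lands in cell 0 of the row, which
  \<open>fill_row\<close> later overwrites with 3.\<close>

definition record_edge :: com where
  "record_edge =
     SetArr ''band''
       (Plus (Times (Arr ''pos'' (Reg ''i'')) (Plus (Reg ''b'') (Const 1))) edge_length)
       (Const 1)"

text \<open>The machine cannot divide, so quotient and remainder are carried along. For
  \<open>b = 0\<close> the test never succeeds, in agreement with \<open>p div 0 = 0\<close> and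
  \<open>p mod 0 = p\<close>.\<close>

definition next_position :: com where
  "next_position =
     Seq (SetReg ''p'' (Plus (Reg ''p'') (Const 1)))
    (Seq (SetReg ''r'' (Plus (Reg ''r'') (Const 1)))
    (If (Equal (Reg ''r'') (Reg ''b''))
       (Seq (SetReg ''r'' (Const 0)) (SetReg ''q'' (Plus (Reg ''q'') (Const 1))))
       Skip))"

definition band_at :: "aexp \<Rightarrow> aexp" where
  "band_at t = Arr ''band'' (Plus (Times (Reg ''p'') (Reg ''k'')) t)"

definition coord_address :: aexp where
  "coord_address = Plus (Times (Arr ''inv'' (Reg ''p'')) (Reg ''k'')) (Reg ''c'')"

definition fill_cell :: com where
  "fill_cell =
     If (Less (Reg ''r'') (Reg ''c''))
       (SetArr ''coord'' coord_address
         (Minus (Plus (Reg ''q'') (Const 3))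
           (band_at (Minus (Plus (Reg ''r'') (Reg ''b'')) (Reg ''c'')))))
       (SetArr ''coord'' coord_address
         (Minus (Plus (Reg ''q'') (Const 4)) (band_at (Minus (Reg ''r'') (Reg ''c'')))))"

definition fill_cells :: com where
  "fill_cells = While (Less (Reg ''c'') (Reg ''b''))
     (Seq fill_cell (SetReg ''c'' (Plus (Reg ''c'') (Const 1))))"

text \<open>The recursion of \<open>shift\<close> is evaluated bottom up in \<open>h\<close>. The
  same code covers \<open>b = 0\<close>: it reads the still empty cell \<open>p\<close> of
  \<open>h\<close>, and the table entry 3 makes the truncated difference 0.\<close>

definition fill_last_cell :: com where
  "fill_last_cell =
     Seq (SetArr ''h'' (Reg ''p'')
           (Plus (Arr ''h'' (Minus (Reg ''p'') (Reg ''b'')))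
             (Minus (Const 2) (Times (Const 2) (band_at (Reg ''b''))))))
         (SetArr ''coord'' coord_address
           (Plus (Times (Plus (Times (Const 2) (Reg ''n'')) (Const 3)) (Reg ''p''))
             (Arr ''h'' (Reg ''p''))))"

definition fill_row :: com where
  "fill_row =
     Seq next_position
    (Seq (SetArr ''band'' (Times (Reg ''p'') (Reg ''k'')) (Const 3))
    (Seq (SetReg ''c'' (Const 0))
    (Seq fill_cells fill_last_cell)))"

definition fill_rows :: com where
  "fill_rows =
     Seq (SetReg ''k'' (Plus (Reg ''b'') (Const 1)))
    (Seq (SetReg ''p'' (Const 0))
    (Seq (SetReg ''q'' (Const 0))
    (Seq (SetReg ''r'' (Const 0))
    (While (Less (Reg ''p'') (Reg ''n'')) fill_row))))"

definition set_lengths :: com where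
  "set_lengths =
     Seq (SetReg ''c'' (Const 0))
    (Seq (While (Less (Reg ''c'') (Reg ''b''))
            (Seq (SetArr ''len'' (Reg ''c'') (Const 2))
                 (SetReg ''c'' (Plus (Reg ''c'') (Const 1)))))
    (SetArr ''len'' (Reg ''b'')
      (Plus (Times (Plus (Times (Const 2) (Reg ''n'')) (Const 3)) (Reg ''b'')) (Const 1))))"

definition cubes_program :: com where
  "cubes_program =
     Seq (edge_scan Skip update_width)
    (Seq (edge_scan record_vertex record_edge)
    (Seq fill_rows set_lengths))"

section \<open>Offsets and row-major addresses\<close>

lemma le_if_le_Suc_below:
  fixes off :: "nat \<Rightarrow> nat"
  assumes "\<And>i. i < n \<Longrightarrow> off i \<le> off (Suc i)" "i \<le> j" "j \<le> n"
  shows "off i \<le> off j"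
  using assms(2,3)
proof (induction j rule: dec_induct)
  case (step m)
  then show ?case using assms(1)[of m] by simp
qed simp

text \<open>Division by the row length recovers row and column from an address.\<close>

lemma cell_eq_iff:
  fixes i j k c d :: nat
  assumes "c < k" "d < k"
  shows "i * k + c = j * k + d \<longleftrightarrow> i = j \<and> c = d"
proof
  assume eq: "i * k + c = j * k + d"
  have "(i * k + c) div k = i" "(j * k + d) div k = j" using assms by simp_all
  with eq show "i = j \<and> c = d" by simp
qed simp

text \<open>The degree bound \<open>off_n\<close> keeps a scan of all lists within O(b n) time. The
  bound on \<open>W\<close> leaves room for all addresses and coordinates, which are at most
  quadratic in \<open>n\<close>.\<close>

locale band_input = band n b nb for n b nb +
  fixes W :: nat and off adj pos :: "nat \<Rightarrow> nat"
  assumes off_0: "off 0 = 0"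
    and off_Suc: "i < n \<Longrightarrow> off i \<le> off (Suc i)"
    and off_n: "off n \<le> 2 * b * n"
    and adj_less: "e < off n \<Longrightarrow> adj e < n"
    and pos_bij: "bij_betw pos {..<n} {1..n}"
    and nb_iff_edge: "i < n \<Longrightarrow> j < n \<Longrightarrow>
      nb (pos i) (pos j) \<longleftrightarrow> (\<exists>e. off i \<le> e \<and> e < off (Suc i) \<and> adj e = j)"
    and W: "4 * (n + 2) * (n + 2) \<le> W"
begin

lemma off_mono: "i \<le> j \<Longrightarrow> j \<le> n \<Longrightarrow> off i \<le> off j"
  using le_if_le_Suc_below off_Suc by blast

lemma W_ge: "4 * (n * n) + 16 * n + 16 \<le> W"
  using W by (simp add: algebra_simps)

lemma off_le_W: "i \<le> n \<Longrightarrow> off i \<le> 2 * (n * n)"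
proof -
  assume "i \<le> n"
  then have "off i \<le> 2 * b * n" using off_mono[of i n] off_n by simp
  also have "\<dots> \<le> 2 * n * n" by (intro mult_le_mono) (use b_le_n in auto)
  finally show ?thesis by simp
qed

lemma pos_range: "i < n \<Longrightarrow> 1 \<le> pos i \<and> pos i \<le> n"
  using bij_betwE[OF pos_bij] by auto

lemma pos_eq_iff: "i < n \<Longrightarrow> j < n \<Longrightarrow> pos i = pos j \<longleftrightarrow> i = j"
  using bij_betw_imp_inj_on[OF pos_bij] by (auto dest: inj_onD)

lemma pos_surj:
  assumes "1 \<le> p" "p \<le> n"
  obtains i where "i < n" "pos i = p"
  using assms bij_betw_imp_surj_on[OF pos_bij] by (metis atLeastAtMost_iff imageE lessThan_iff)

section \<open>Edges as cells of the adjacency array\<close>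

definition edge_of :: "nat \<Rightarrow> nat \<Rightarrow> bool" where
  "edge_of i e \<longleftrightarrow> i < n \<and> off i \<le> e \<and> e < off (Suc i)"

lemma edge_of_less: "edge_of i e \<Longrightarrow> e < off n"
  unfolding edge_of_def using off_mono[of "Suc i" n] by simp

lemma edge_of_unique: "edge_of i e \<Longrightarrow> edge_of j e \<Longrightarrow> i = j"
proof (induction i j rule: linorder_wlog)
  case (le i j)
  then show ?case
    using off_mono[of "Suc i" j] unfolding edge_of_def
    by (metis le_antisym not_less_eq_eq not_less order_less_le_trans less_imp_le)
qed auto

lemma edge_of_nb: "edge_of i e \<Longrightarrow> nb (pos i) (pos (adj e))"
  using nb_iff_edge[of i "adj e"] adj_less[OF edge_of_less] unfolding edge_of_def by blast

lemma nb_edge_of: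
  assumes "nb p q"
  obtains i e where "edge_of i e" "pos i = p" "pos (adj e) = q"
proof -
  obtain i where i: "i < n" "pos i = p" using pos_surj nb_range assms by (metis atLeastAtMost_iff)
  obtain j where j: "j < n" "pos j = q" using pos_surj nb_range assms by (metis atLeastAtMost_iff)
  with i assms nb_iff_edge[of i j] show ?thesis using that unfolding edge_of_def by blast
qed

text \<open>In \<open>J i e x a\<close> the first \<open>i\<close> vertices have undergone
  \<open>pre\<close> and the first \<open>e\<close> cells \<open>body\<close>; \<open>x\<close> is
  the content of register \<open>b\<close> and \<open>a\<close> the memory. The potential counts the
  vertices and cells still ahead, so the cost is amortised however the cells are spread over the
  lists.\<close>

lemma wp_edge_scan:
  fixes J :: "nat \<Rightarrow> nat \<Rightarrow> nat \<Rightarrow> (string \<Rightarrow> nat \<Rightarrow> nat) \<Rightarrow> bool"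
  assumes n: "reg s ''n'' = n" and init: "J 0 0 (reg s ''b'') (arr s)"
    and J_off: "\<And>i e x a. J i e x a \<Longrightarrow> a ''off'' = off"
    and pre: "\<And>i s. i < n \<Longrightarrow> reg s ''i'' = i \<Longrightarrow> reg s ''n'' = n \<Longrightarrow>
      J i (off i) (reg s ''b'') (arr s) \<Longrightarrow>
      wp W pre (\<lambda>t s'. t \<le> c \<and> (\<forall>x\<in>{''n'', ''i'', ''e''}. reg s' x = reg s x) \<and>
        J (Suc i) (off i) (reg s' ''b'') (arr s')) s"
    and body: "\<And>i e s. edge_of i e \<Longrightarrow> reg s ''i'' = i \<Longrightarrow> reg s ''n'' = n \<Longrightarrow> reg s ''e'' = e \<Longrightarrow>
      J (Suc i) e (reg s ''b'') (arr s) \<Longrightarrow>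
      wp W body (\<lambda>t s'. t \<le> c \<and> (\<forall>x\<in>{''n'', ''i'', ''e''}. reg s' x = reg s x) \<and>
        J (Suc i) (Suc e) (reg s' ''b'') (arr s')) s"
    and Q: "\<And>t s'. t \<le> 7 + n * (13 + c) + off n * (10 + c) \<Longrightarrow> reg s' ''n'' = n \<Longrightarrow>
      J n (off n) (reg s' ''b'') (arr s') \<Longrightarrow> Q t s'"
  shows "wp W (edge_scan pre body) Q s"
proof -
  define I where "I s \<longleftrightarrow> reg s ''n'' = n \<and> reg s ''i'' \<le> n \<and> reg s ''e'' = off (reg s ''i'') \<and>
    J (reg s ''i'') (off (reg s ''i'')) (reg s ''b'') (arr s)" for s :: state
  \<comment> \<open>Per vertex: outer test 3, \<open>pre\<close> at most \<open>c\<close>, failing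
    inner test 6, increment 4. Per cell: inner test 6, \<open>body\<close> at most \<open>c\<close>,
    increment 4. The initial 3 pays for the last outer test.\<close>
  define \<mu> where "\<mu> s = 3 + (n - reg s ''i'') * (13 + c) + (off n - reg s ''e'') * (10 + c)" for s :: state
  define I' where "I' i s \<longleftrightarrow> reg s ''n'' = n \<and> reg s ''i'' = i \<and> off i \<le> reg s ''e'' \<and>
    reg s ''e'' \<le> off (Suc i) \<and> J (Suc i) (reg s ''e'') (reg s ''b'') (arr s)" for i and s :: state
  define \<mu>' where "\<mu>' i s = 6 + (off (Suc i) - reg s ''e'') * (10 + c)" for i and s :: state
  let ?c' = "Less (Reg ''e'') (Arr ''off'' (Plus (Reg ''i'') (Const 1)))"
  let ?b' = "Seq body (SetReg ''e'' (Plus (Reg ''e'') (Const 1)))"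
  have inner: "wp W (While ?c' ?b') (\<lambda>t s'. t \<le> \<mu>' i s \<and> I' i s' \<and> reg s' ''e'' = off (Suc i)) s"
    if i: "i < n" and s: "I' i s" for i s
  proof (rule wp_While[of "I' i" _ _ _ _ "\<mu>' i"])
    fix s assume I: "I' i s"
    then have off: "arr s ''off'' = off" using J_off unfolding I'_def by blast
    have le: "off (Suc i) \<le> 2 * (n * n)" using off_le_W[of "Suc i"] i by simp
    show "bfits W ?c' s" using I off le i W_ge by (simp add: I'_def)
    show "bcost ?c' \<le> \<mu>' i s" by (simp add: \<mu>'_def)
    assume "bval ?c' s"
    then have e: "edge_of i (reg s ''e'')" using I off i by (simp add: I'_def edge_of_def)
    show "wp W ?b' (\<lambda>t s'. I' i s' \<and> bcost ?c' + t + \<mu>' i s' \<le> \<mu>' i s) s"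
    proof (rule wp_Seq, rule wp_mono, rule body[OF e])
      fix t :: nat and s' :: state
      assume s': "t \<le> c \<and> (\<forall>x\<in>{''n'', ''i'', ''e''}. reg s' x = reg s x) \<and>
        J (Suc i) (Suc (reg s ''e'')) (reg s' ''b'') (arr s')"
      have "off (Suc i) - reg s ''e'' = Suc (off (Suc i) - Suc (reg s ''e''))"
        using e unfolding edge_of_def by linarith
      then show "wp W (SetReg ''e'' (Plus (Reg ''e'') (Const 1)))
         (\<lambda>t'. \<lambda>s'. I' i s' \<and> bcost ?c' + (t + t') + \<mu>' i s' \<le> \<mu>' i s) s'"
        using s' I e le W_ge
        by (intro wp_SetReg) (simp_all add: I'_def \<mu>'_def edge_of_def)
    qed (use I in \<open>auto simp: I'_def\<close>)
  next
    fix t :: nat and s' :: state assume "I' i s'" "\<not> bval ?c' s'" "t \<le> \<mu>' i s"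
    moreover from this have "arr s' ''off'' = off" using J_off unfolding I'_def by blast
    ultimately show "t \<le> \<mu>' i s \<and> I' i s' \<and> reg s' ''e'' = off (Suc i)"
      by (auto simp: I'_def)
  qed (fact s)
  let ?c = "Less (Reg ''i'') (Reg ''n'')"
  let ?i = "SetReg ''i'' (Plus (Reg ''i'') (Const 1))"
  let ?b = "Seq pre (Seq (While ?c' ?b') ?i)"
  have outer: "wp W (While ?c ?b) (\<lambda>t s'. t \<le> \<mu> s \<and> I s' \<and> reg s' ''i'' = n) s"
    if s: "I s" for s
  proof (rule wp_While[of I _ _ _ _ \<mu>])
    fix s assume I: "I s"
    show "bfits W ?c s" using I W_ge by (simp add: I_def)
    show "bcost ?c \<le> \<mu> s" by (simp add: \<mu>_def)
    assume "bval ?c s"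
    define i where "i = reg s ''i''"
    have i: "i < n" using I \<open>bval ?c s\<close> by (simp add: I_def i_def)
    have offs: "off i \<le> off (Suc i)" "off (Suc i) \<le> off n" using off_mono i by simp_all
    show "wp W ?b (\<lambda>t s'. I s' \<and> bcost ?c + t + \<mu> s' \<le> \<mu> s) s"
    proof (rule wp_Seq, rule wp_mono, rule pre[OF i])
      fix t :: nat and s1 :: state
      assume s1: "t \<le> c \<and> (\<forall>x\<in>{''n'', ''i'', ''e''}. reg s1 x = reg s x) \<and>
        J (Suc i) (off i) (reg s1 ''b'') (arr s1)"
      then have I1: "I' i s1" using I offs by (simp add: I_def I'_def i_def)
      have e1: "reg s1 ''e'' = off i" using s1 I by (simp add: I_def i_def)
      show "wp W (Seq (While ?c' ?b') ?i)
        (\<lambda>t' s'. I s' \<and> bcost ?c + (t + t') + \<mu> s' \<le> \<mu> s) s1"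
      proof (rule wp_Seq, rule wp_mono, rule inner[OF i I1])
        fix t' :: nat and s2 :: state
        assume s2: "t' \<le> \<mu>' i s1 \<and> I' i s2 \<and> reg s2 ''e'' = off (Suc i)"
        have n_i: "n - i = Suc (n - Suc i)" using i by simp
        have o: "off n - off i = (off (Suc i) - off i) + (off n - off (Suc i))"
          using offs by simp
        have "\<mu> s = 3 + (n - i) * (13 + c) + (off n - off i) * (10 + c)"
          using I by (simp add: \<mu>_def I_def i_def)
        then have "3 + t + t' + 4 + (3 + (n - Suc i) * (13 + c) + (off n - off (Suc i)) * (10 + c)) \<le> \<mu> s"
          unfolding n_i o using s1 s2 e1 by (simp add: \<mu>'_def add_mult_distrib)
        then show "wp W ?i (\<lambda>t'' s'. I s' \<and> bcost ?c + (t + (t' + t'')) + \<mu> s' \<le> \<mu> s) s2"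
          using s2 i W_ge by (intro wp_SetReg) (auto simp: I_def I'_def \<mu>_def)
      qed
    qed (use I in \<open>auto simp: I_def i_def\<close>)
  next
    fix t :: nat and s' :: state assume "I s'" "\<not> bval ?c s'" "t \<le> \<mu> s"
    then show "t \<le> \<mu> s \<and> I s' \<and> reg s' ''i'' = n" by (auto simp: I_def)
  qed (fact s)
  show ?thesis
    unfolding edge_scan_def
  proof (rule wp_Seq, rule wp_SetReg, simp, rule wp_Seq, rule wp_SetReg, simp,
      rule wp_mono, rule outer)
    show "I (s\<lparr>reg := (reg s)(''i'' := aval (Const 0) s)\<rparr>
        \<lparr>reg := (reg (s\<lparr>reg := (reg s)(''i'' := aval (Const 0) s)\<rparr>))
          (''e'' := aval (Const 0) (s\<lparr>reg := (reg s)(''i'' := aval (Const 0) s)\<rparr>))\<rparr>)"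
      using n init by (simp add: I_def off_0)
  qed (auto intro!: Q simp: I_def \<mu>_def)
qed

section \<open>Finding the width\<close>

definition inputs :: "(string \<Rightarrow> nat \<Rightarrow> nat) \<Rightarrow> bool" where
  "inputs a \<longleftrightarrow> a ''off'' = off \<and> a ''adj'' = adj \<and> a ''pos'' = pos \<and> a ''h'' = (\<lambda>_. 0)"

lemma fits_edge_length:
  assumes "edge_of i e" "reg s ''i'' = i" "reg s ''e'' = e" "inputs (arr s)"
  shows "fits W edge_length s \<and> aval edge_length s = pos i - pos (adj e) \<and> pos i - pos (adj e) \<le> b"
proof -
  have "e < off n" "i < n" using edge_of_less assms by (auto simp: edge_of_def)
  then have "adj e < n" "pos i \<le> n" "pos (adj e) \<le> n" using adj_less pos_range by auto
  moreover have "off n \<le> 2 * (n * n)" using off_le_W by simp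
  moreover have "pos i \<le> pos (adj e) + b" using edge_of_nb[OF assms(1)] nb_width by blast
  ultimately show ?thesis using assms \<open>e < off n\<close> \<open>i < n\<close> W_ge
    unfolding edge_length_def inputs_def by simp linarith
qed

text \<open>An upper bound on the lengths seen so far suffices as invariant: together with
  \<open>x \<le> b\<close> it forces \<open>x = b\<close> at the end, because the width is attained
  by a scanned edge.\<close>

definition max_length_le :: "nat \<Rightarrow> nat \<Rightarrow> bool" where
  "max_length_le e x \<longleftrightarrow> (\<forall>i' e'. edge_of i' e' \<longrightarrow> e' < e \<longrightarrow> pos i' - pos (adj e') \<le> x)"

lemma max_length_le_Suc:
  assumes "edge_of i e"
  shows "max_length_le (Suc e) x \<longleftrightarrow> max_length_le e x \<and> pos i - pos (adj e) \<le> x"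
  unfolding max_length_le_def using assms edge_of_unique by (metis less_Suc_eq)

lemma max_length_le_mono: "max_length_le e x \<Longrightarrow> x \<le> y \<Longrightarrow> max_length_le e y"
  unfolding max_length_le_def by (meson order_trans)

lemma wp_width_scan:
  assumes n: "reg s ''n'' = n" and b: "reg s ''b'' = 0" and inp: "inputs (arr s)"
    and Q: "\<And>t s'. t \<le> 7 + n * 29 + off n * 26 \<Longrightarrow> reg s' ''n'' = n \<Longrightarrow> reg s' ''b'' = b \<Longrightarrow>
      arr s' = arr s \<Longrightarrow> Q t s'"
  shows "wp W (edge_scan Skip update_width) Q s"
proof (rule wp_edge_scan[where J = "\<lambda>i e x a. a = arr s \<and> x \<le> b \<and> max_length_le e x" and c = 16])
  fix i and s' :: state
  assume "arr s' = arr s \<and> reg s' ''b'' \<le> b \<and> max_length_le (off i) (reg s' ''b'')"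
  then show "wp W Skip (\<lambda>t s''. t \<le> 16 \<and> (\<forall>x\<in>{''n'', ''i'', ''e''}. reg s'' x = reg s' x) \<and>
     arr s'' = arr s \<and> reg s'' ''b'' \<le> b \<and> max_length_le (off i) (reg s'' ''b'')) s'"
    by (intro wp_Skip) auto
next
  fix i e and s' :: state
  assume e: "edge_of i e" "reg s' ''i'' = i" "reg s' ''e'' = e"
    and J: "arr s' = arr s \<and> reg s' ''b'' \<le> b \<and> max_length_le e (reg s' ''b'')"
  let ?d = "pos i - pos (adj e)"
  have len: "fits W edge_length s'" "aval edge_length s' = ?d" "?d \<le> b"
    using fits_edge_length[OF e] inp J by auto
  have cost: "acost edge_length = 6" by (simp add: edge_length_def)
  have b_le: "reg s' ''b'' \<le> W" using J b_le_n W_ge by linarith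
  show "wp W update_width (\<lambda>t s''. t \<le> 16 \<and>
      (\<forall>x\<in>{''n'', ''i'', ''e''}. reg s'' x = reg s' x) \<and>
      arr s'' = arr s \<and> reg s'' ''b'' \<le> b \<and> max_length_le (Suc e) (reg s'' ''b'')) s'"
    unfolding update_width_def
  proof (rule wp_If)
    show "bfits W (Less (Reg ''b'') edge_length) s'" using len b_le by simp
  next
    assume "bval (Less (Reg ''b'') edge_length) s'"
    then have "max_length_le (Suc e) ?d"
      using J len max_length_le_Suc[OF e(1)] max_length_le_mono[of e "reg s' ''b''" ?d] by simp
    then show "wp W (SetReg ''b'' edge_length)
      (\<lambda>t s''. bcost (Less (Reg ''b'') edge_length) + t \<le> 16 \<and>
      (\<forall>x\<in>{''n'', ''i'', ''e''}. reg s'' x = reg s' x) \<and>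
      arr s'' = arr s \<and> reg s'' ''b'' \<le> b \<and> max_length_le (Suc e) (reg s'' ''b'')) s'"
      using len J by (intro wp_SetReg) (simp_all add: cost)
  next
    assume "\<not> bval (Less (Reg ''b'') edge_length) s'"
    then have "max_length_le (Suc e) (reg s' ''b'')"
      using J len max_length_le_Suc[OF e(1)] by simp
    then show "wp W Skip
      (\<lambda>t s''. bcost (Less (Reg ''b'') edge_length) + t \<le> 16 \<and>
      (\<forall>x\<in>{''n'', ''i'', ''e''}. reg s'' x = reg s' x) \<and>
      arr s'' = arr s \<and> reg s'' ''b'' \<le> b \<and> max_length_le (Suc e) (reg s'' ''b'')) s'"
      using len J by (intro wp_Skip) (simp add: cost)
  qed
next
  fix t :: nat and s' :: state
  assume t: "t \<le> 7 + n * (13 + 16) + off n * (10 + 16)" and n: "reg s' ''n'' = n"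
    and J: "arr s' = arr s \<and> reg s' ''b'' \<le> b \<and> max_length_le (off n) (reg s' ''b'')"
  have "b \<le> reg s' ''b''"
    using width_attained
  proof
    assume "\<exists>p. nb (p + b) p"
    then obtain p i e where e: "edge_of i e" "pos i = p + b" "pos (adj e) = p"
      using nb_edge_of by metis
    then have "pos i - pos (adj e) \<le> reg s' ''b''"
      using J edge_of_less unfolding max_length_le_def by blast
    with e show ?thesis by simp
  qed simp
  with t n J Q show "Q t s'" by simp
qed (use n b inp in \<open>auto simp: inputs_def max_length_le_def\<close>)

section \<open>The table of adjacencies within the band\<close>

definition has_edges :: "nat \<Rightarrow> (string \<Rightarrow> nat \<Rightarrow> nat) \<Rightarrow> bool" where
  "has_edges e a \<longleftrightarrow> (\<forall>p t. 1 \<le> t \<longrightarrow> t \<le> b \<longrightarrow> a ''band'' (p * (b + 1) + t) =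
     (if \<exists>i' e'. edge_of i' e' \<and> e' < e \<and> pos i' = p \<and> pos i' - pos (adj e') = t then 1 else 0))"

lemma wp_band_scan:
  assumes n: "reg s ''n'' = n" and b: "reg s ''b'' = b" and inp: "inputs (arr s)"
    and band0: "arr s ''band'' = (\<lambda>_. 0)"
    and Q: "\<And>t s'. t \<le> 7 + n * 29 + off n * 26 \<Longrightarrow> reg s' ''n'' = n \<Longrightarrow> reg s' ''b'' = b \<Longrightarrow>
      inputs (arr s') \<Longrightarrow> (\<And>i. i < n \<Longrightarrow> arr s' ''inv'' (pos i) = i) \<Longrightarrow>
      (\<And>p t. 1 \<le> t \<Longrightarrow> t \<le> b \<Longrightarrow> arr s' ''band'' (p * (b + 1) + t) = band_entry p t) \<Longrightarrow> Q t s'"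
  shows "wp W (edge_scan record_vertex record_edge) Q s"
proof (rule wp_edge_scan[where J = "\<lambda>i e x a. x = b \<and> inputs a \<and>
      (\<forall>i'<i. a ''inv'' (pos i') = i') \<and> has_edges e a" and c = 16])
  fix i and s' :: state
  assume i: "i < n" "reg s' ''i'' = i"
    and J: "reg s' ''b'' = b \<and> inputs (arr s') \<and> (\<forall>i'<i. arr s' ''inv'' (pos i') = i') \<and>
      has_edges (off i) (arr s')"
  have "\<forall>i'<i. pos i' \<noteq> pos i" using pos_eq_iff i by auto
  then show "wp W record_vertex (\<lambda>t s''. t \<le> 16 \<and>
      (\<forall>x\<in>{''n'', ''i'', ''e''}. reg s'' x = reg s' x) \<and> reg s'' ''b'' = b \<and> inputs (arr s'') \<and>
      (\<forall>i'<Suc i. arr s'' ''inv'' (pos i') = i') \<and> has_edges (off i) (arr s'')) s'"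
    unfolding record_vertex_def using i J W_ge pos_range[of i]
    by (intro wp_SetArr) (auto simp: inputs_def has_edges_def less_Suc_eq)
next
  fix i e and s' :: state
  assume e: "edge_of i e" "reg s' ''i'' = i" "reg s' ''e'' = e"
    and J: "reg s' ''b'' = b \<and> inputs (arr s') \<and> (\<forall>i'<Suc i. arr s' ''inv'' (pos i') = i') \<and>
      has_edges e (arr s')"
  let ?d = "pos i - pos (adj e)"
  have len: "fits W edge_length s'" "aval edge_length s' = ?d" "?d \<le> b"
    using fits_edge_length[OF e] J by auto
  have cost: "acost edge_length = 6" by (simp add: edge_length_def)
  have i: "i < n" using e by (simp add: edge_of_def)
  have "pos i * (b + 1) \<le> n * (n + 1)" using pos_range[OF i] b_le_n by (intro mult_le_mono) auto
  then have idx: "pos i * (b + 1) + b \<le> W" using W_ge b_le_n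
    by (simp add: add_mult_distrib2)
  have ex: "(\<exists>i' e'. edge_of i' e' \<and> e' < Suc e \<and> pos i' = p \<and> pos i' - pos (adj e') = t) \<longleftrightarrow>
      p = pos i \<and> t = ?d \<or>
      (\<exists>i' e'. edge_of i' e' \<and> e' < e \<and> pos i' = p \<and> pos i' - pos (adj e') = t)" for p t
    using e(1) edge_of_unique by (metis less_Suc_eq)
  \<comment> \<open>Only cells with \<open>t \<ge> 1\<close> are constrained, so a stray write with
    \<open>?d = 0\<close> preserves the invariant.\<close>
  have he: "has_edges (Suc e) ((arr s')(''band'' := (arr s' ''band'')(pos i * (b + 1) + ?d := 1)))"
    unfolding has_edges_def
  proof (intro allI impI)
    fix p t assume t: "1 \<le> t" "t \<le> b"
    have cell: "p * (b + 1) + t = pos i * (b + 1) + ?d \<longleftrightarrow> p = pos i \<and> t = ?d"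
      using t len by (intro cell_eq_iff) auto
    have old: "arr s' ''band'' (p * (b + 1) + t) =
        (if \<exists>i' e'. edge_of i' e' \<and> e' < e \<and> pos i' = p \<and> pos i' - pos (adj e') = t then 1 else 0)"
      using J t unfolding has_edges_def by blast
    show "((arr s')(''band'' := (arr s' ''band'')(pos i * (b + 1) + ?d := 1))) ''band''
        (p * (b + 1) + t) = (if \<exists>i' e'. edge_of i' e' \<and> e' < Suc e \<and> pos i' = p \<and>
          pos i' - pos (adj e') = t then 1 else 0)"
      unfolding ex fun_upd_same fun_upd_apply[of _ "pos i * (b + 1) + ?d"] cell old
      by (cases "p = pos i \<and> t = ?d") (simp_all only: simp_thms if_True if_False)
  qed
  show "wp W record_edge (\<lambda>t s''. t \<le> 16 \<and>
      (\<forall>x\<in>{''n'', ''i'', ''e''}. reg s'' x = reg s' x) \<and> reg s'' ''b'' = b \<and> inputs (arr s'') \<and>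
      (\<forall>i'<Suc i. arr s'' ''inv'' (pos i') = i') \<and> has_edges (Suc e) (arr s'')) s'"
    (is "wp W _ ?Q _")
    unfolding record_edge_def
  proof (rule wp_SetArr)
    have posi: "pos i \<le> W" and bW: "b + 1 \<le> W" and "i \<le> W" and "1 \<le> W"
      using pos_range[OF i] b_le_n W_ge i by linarith+
    have addr: "aval (Plus (Times (Arr ''pos'' (Reg ''i'')) (Plus (Reg ''b'') (Const 1)))
        edge_length) s' = pos i * (b + 1) + ?d"
      using len J e by (simp add: inputs_def)
    have "pos i * (b + 1) \<le> W" "pos i * (b + 1) + ?d \<le> W" using idx len by linarith+
    then show "fits W (Plus (Times (Arr ''pos'' (Reg ''i'')) (Plus (Reg ''b'') (Const 1)))
        edge_length) s'"
      using len J e posi bW \<open>i \<le> W\<close> \<open>1 \<le> W\<close> by (simp add: inputs_def)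
    show "fits W (Const 1) s'" using \<open>1 \<le> W\<close> by simp
    show "?Q (1 + acost (Plus (Times (Arr ''pos'' (Reg ''i'')) (Plus (Reg ''b'') (Const 1)))
        edge_length) + acost (Const 1))
      (s'\<lparr>arr := (arr s')(''band'' := (arr s' ''band'')
        (aval (Plus (Times (Arr ''pos'' (Reg ''i'')) (Plus (Reg ''b'') (Const 1)))
        edge_length) s' := aval (Const 1) s'))\<rparr>)"
      unfolding addr using J he by (simp add: cost inputs_def)
  qed
next
  fix t :: nat and s' :: state
  assume t: "t \<le> 7 + n * (13 + 16) + off n * (10 + 16)" and n: "reg s' ''n'' = n"
    and J: "reg s' ''b'' = b \<and> inputs (arr s') \<and>
      (\<forall>i'<n. arr s' ''inv'' (pos i') = i') \<and> has_edges (off n) (arr s')"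
  have "arr s' ''band'' (p * (b + 1) + t) = band_entry p t" if t: "1 \<le> t" "t \<le> b" for p t
  proof -
    have "(\<exists>i' e'. edge_of i' e' \<and> e' < off n \<and> pos i' = p \<and> pos i' - pos (adj e') = t) \<longleftrightarrow>
      nb p (p - t)"
    proof
      assume "\<exists>i' e'. edge_of i' e' \<and> e' < off n \<and> pos i' = p \<and> pos i' - pos (adj e') = t"
      then obtain i' e' where e': "edge_of i' e'" "pos i' = p" "p - pos (adj e') = t" by blast
      then have "p - t = pos (adj e')" using t by linarith
      then show "nb p (p - t)" using edge_of_nb e' by metis
    next
      assume nb: "nb p (p - t)"
      then obtain i' e' where e': "edge_of i' e'" "pos i' = p" "pos (adj e') = p - t"
        using nb_edge_of by blast
      \<comment> \<open>As 0 is no position, \<open>p - t\<close> is not truncated, and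
        \<open>p - (p - t)\<close> is \<open>t\<close>.\<close>
      moreover have "p - t \<noteq> 0" using nb_range[OF nb] by auto
      ultimately show "\<exists>i' e'. edge_of i' e' \<and> e' < off n \<and> pos i' = p \<and> pos i' - pos (adj e') = t"
        using edge_of_less by (metis diff_diff_cancel less_imp_le zero_less_diff neq0_conv)
    qed
    then show ?thesis using J t unfolding has_edges_def by (simp add: band_entry_def)
  qed
  with t n J Q show "Q t s'" by auto
qed (use n b inp band0 in \<open>auto simp: inputs_def has_edges_def\<close>)

section \<open>Filling in the cube corners by rows\<close>

definition rows_filled :: "nat \<Rightarrow> (string \<Rightarrow> nat \<Rightarrow> nat) \<Rightarrow> bool" where
  "rows_filled p a \<longleftrightarrow>
     (\<forall>i<n. a ''inv'' (pos i) = i) \<and>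
     (\<forall>p' t. 1 \<le> t \<longrightarrow> t \<le> b \<longrightarrow> a ''band'' (p' * (b + 1) + t) = band_entry p' t) \<and>
     (\<forall>p'. a ''h'' p' = (if p' \<le> p then shift p' else 0)) \<and>
     (\<forall>i<n. \<forall>c\<le>b. pos i \<le> p \<longrightarrow> a ''coord'' (i * (b + 1) + c) = coord (pos i) c)"

text \<open>\<open>rows_filled\<close> leaves cell 0 of the table rows open, since stray writes may
  have put a 1 there. For the current row it is included, as it has just been set to 3.\<close>

definition row_filled :: "nat \<Rightarrow> nat \<Rightarrow> (string \<Rightarrow> nat \<Rightarrow> nat) \<Rightarrow> bool" where
  "row_filled i c a \<longleftrightarrow> rows_filled (pos i - 1) a \<and>
     (\<forall>t\<le>b. a ''band'' (pos i * (b + 1) + t) = band_entry (pos i) t) \<and>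
     (\<forall>c'<c. a ''coord'' (i * (b + 1) + c') = short_coord (pos i) c')"

lemma row_filled_0:
  assumes "rows_filled (pos i - 1) a"
  shows "row_filled i 0 (a(''band'' := (a ''band'')(pos i * (b + 1) := 3)))"
proof -
  have cell: "p' * (b + 1) + t \<noteq> pos i * (b + 1)" if "1 \<le> t" "t \<le> b" for p' t
    using cell_eq_iff[of t "b + 1" 0 p' "pos i"] that by (metis One_nat_def Suc_eq_plus1
      add.right_neutral le_imp_less_Suc not_one_le_zero zero_less_Suc)
  have "rows_filled (pos i - 1) (a(''band'' := (a ''band'')(pos i * (b + 1) := 3)))"
    using assms cell unfolding rows_filled_def fun_upd_same
    by (simp del: mult_Suc_right add_mult_distrib2 One_nat_def add_Suc_right)
  moreover have "((a ''band'')(pos i * (b + 1) := 3)) (pos i * (b + 1) + t) = band_entry (pos i) t"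
    if "t \<le> b" for t
  proof (cases "t = 0")
    case False
    then have "1 \<le> t" by simp
    then have "a ''band'' (pos i * (b + 1) + t) = band_entry (pos i) t"
      using that assms unfolding rows_filled_def by blast
    then show ?thesis using False by simp
  qed (simp add: band_entry_def)
  ultimately show ?thesis unfolding row_filled_def by simp
qed

text \<open>\<open>coord\<close> is laid out by vertex number, while rows are completed in the order
  of positions. A finished row has a smaller position, hence another vertex, hence other
  addresses.\<close>

lemma row_filled_Suc:
  assumes i: "i < n" and c: "c < b" and a: "row_filled i c a"
  shows "row_filled i (Suc c)
    (a(''coord'' := (a ''coord'')(i * (b + 1) + c := short_coord (pos i) c)))"
proof -
  have 1: "i' * (b + 1) + c' \<noteq> i * (b + 1) + c" if "i' < n" "c' \<le> b" "pos i' \<le> pos i - 1" for i' c'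
  proof
    assume "i' * (b + 1) + c' = i * (b + 1) + c"
    then have "i' = i" using cell_eq_iff[of c' "b + 1" c i' i] that c by simp
    with that pos_range[OF i] show False by auto
  qed
  have 2: "i * (b + 1) + c' \<noteq> i * (b + 1) + c" if "c' < c" for c' using that by simp
  show ?thesis
    using a 1 2 unfolding row_filled_def rows_filled_def fun_upd_same less_Suc_eq
    by (auto simp only: fun_upd_apply simp_thms if_False if_True list.inject char.inject)
qed

lemma rows_filled_row:
  assumes i: "i < n" and a: "row_filled i b a"
  shows "rows_filled (pos i) (a(''h'' := (a ''h'')(pos i := shift (pos i)),
    ''coord'' := (a ''coord'')(i * (b + 1) + b := long_coord (pos i))))"
proof -
  have pos: "1 \<le> pos i" using pos_range[OF i] by simp
  have 1: "i' * (b + 1) + c' = i * (b + 1) + b \<longleftrightarrow> i' = i \<and> c' = b" if "c' \<le> b" for i' c'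
    using cell_eq_iff[of c' "b + 1" b i' i] that by simp
  have "((a ''coord'')(i * (b + 1) + b := long_coord (pos i))) (i' * (b + 1) + c) = coord (pos i') c"
    if i': "i' < n" "c \<le> b" "pos i' \<le> pos i" for i' c
  proof (cases "i' = i")
    case True
    then show ?thesis
      using a 1[OF i'(2)] i' by (auto simp: row_filled_def coord_def)
  next
    case False
    then have "pos i' \<le> pos i - 1" using pos_eq_iff[OF i'(1) i] i' by linarith
    then show ?thesis using False i' 1[OF i'(2)] a
      unfolding row_filled_def rows_filled_def by (simp only: fun_upd_apply) simp
  qed
  moreover have "((a ''h'')(pos i := shift (pos i))) p = (if p \<le> pos i then shift p else 0)" for p
    using a pos unfolding row_filled_def rows_filled_def by auto
  ultimately show ?thesis
    using a unfolding row_filled_def rows_filled_def by simp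
qed

lemma wp_next_position:
  assumes "reg s ''p'' = p" "p < n" "reg s ''r'' = p mod b" "reg s ''q'' = p div b" "reg s ''b'' = b"
  shows "wp W next_position (\<lambda>t s'. t \<le> 17 \<and> arr s' = arr s \<and>
    (\<forall>x\<in>{''n'', ''b'', ''k''}. reg s' x = reg s x) \<and>
    reg s' ''p'' = Suc p \<and> reg s' ''r'' = Suc p mod b \<and> reg s' ''q'' = Suc p div b) s"
proof -
  have le: "p mod b < n" "p div b < n"
    using assms(2) mod_less_eq_dividend[of p b] div_le_dividend[of p b] by linarith+
  show ?thesis
    unfolding next_position_def
    using assms b_le_n W_ge le
    by (intro wp_Seq wp_SetReg wp_If wp_Skip) (simp_all add: mod_Suc div_Suc)
qed

lemma mult_k_le: "x \<le> n \<Longrightarrow> x * (b + 1) \<le> n * n + n"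
  using mult_le_mono[of x n "b + 1" "n + 1"] b_le_n by simp

lemma band_at_correct:
  assumes "row_filled i c (arr s)" "i < n" "reg s ''p'' = pos i" "reg s ''k'' = b + 1"
    and "fits W e s" "aval e s = t" "t \<le> b"
  shows "fits W (band_at e) s \<and> aval (band_at e) s = band_entry (pos i) t"
proof -
  have "arr s ''band'' (pos i * (b + 1) + t) = band_entry (pos i) t"
    using assms unfolding row_filled_def by blast
  moreover have "band_entry (pos i) t \<le> 3" by (simp add: band_entry_def)
  moreover have "pos i * (b + 1) \<le> n * n + n" "pos i \<le> n"
    using mult_k_le pos_range assms by simp_all
  ultimately show ?thesis using assms W_ge b_le_n
    unfolding band_at_def by (simp del: mult_Suc_right)
qed

lemma coord_address_correct:
  assumes "row_filled i c (arr s)" "i < n" "reg s ''p'' = pos i" "reg s ''k'' = b + 1"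
    and "reg s ''c'' = c" "c \<le> b"
  shows "fits W coord_address s \<and> aval coord_address s = i * (b + 1) + c"
proof -
  have "arr s ''inv'' (pos i) = i" using assms unfolding row_filled_def rows_filled_def by blast
  moreover have "i * (b + 1) \<le> n * n + n" using mult_k_le assms by simp
  ultimately show ?thesis using assms W_ge b_le_n pos_range[of i]
    unfolding coord_address_def by (simp del: mult_Suc_right)
qed

definition row_regs :: "nat \<Rightarrow> state \<Rightarrow> bool" where
  "row_regs i s \<longleftrightarrow> reg s ''n'' = n \<and> reg s ''b'' = b \<and> reg s ''k'' = b + 1 \<and>
     reg s ''p'' = pos i \<and> reg s ''r'' = pos i mod b \<and> reg s ''q'' = pos i div b"

lemma wp_fill_cell:
  assumes i: "i < n" and c: "c < b" "reg s ''c'' = c"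
    and regs: "row_regs i s" and row: "row_filled i c (arr s)"
  shows "wp W fill_cell (\<lambda>t s'. t \<le> 24 \<and> reg s' = reg s \<and> row_filled i (Suc c) (arr s')) s"
proof -
  have r: "pos i mod b < b" "pos i mod b \<le> n" "pos i div b \<le> n" "b \<le> n"
    using pos_range[OF i] c b_le_n div_le_dividend[of "pos i" b] mod_less_eq_dividend[of "pos i" b]
    mod_less_divisor[of b "pos i"] by linarith+
  note addr = coord_address_correct[OF row i]
  let ?e1 = "Minus (Plus (Reg ''r'') (Reg ''b'')) (Reg ''c'')"
  let ?e2 = "Minus (Reg ''r'') (Reg ''c'')"
  have a: "fits W coord_address s" "aval coord_address s = i * (b + 1) + c"
    using addr regs c by (auto simp: row_regs_def)
  have e1: "fits W (band_at ?e1) s \<and> aval (band_at ?e1) s = band_entry (pos i) (pos i mod b + b - c)"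
    if "pos i mod b < c"
    using band_at_correct[OF row i, of ?e1] regs c that r W_ge by (auto simp: row_regs_def)
  have e2: "fits W (band_at ?e2) s \<and> aval (band_at ?e2) s = band_entry (pos i) (pos i mod b - c)"
  proof -
    have "pos i mod b - c \<le> b" using r by linarith
    then show ?thesis
      using band_at_correct[OF row i, of ?e2 "pos i mod b - c"] regs c r W_ge
      by (simp add: row_regs_def)
  qed
  have cost: "acost coord_address = 6" "\<And>e. acost (band_at e) = 5 + acost e"
    by (simp_all add: coord_address_def band_at_def)
  note Suc = row_filled_Suc[OF i c(1) row, unfolded short_coord_def]
  show ?thesis
    unfolding fill_cell_def
  proof (rule wp_If)
    show "bfits W (Less (Reg ''r'') (Reg ''c'')) s"
      using regs c r W_ge by (simp add: row_regs_def)
  next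
    assume "bval (Less (Reg ''r'') (Reg ''c'')) s"
    then have lt: "pos i mod b < c" using regs c by (simp add: row_regs_def)
    show "wp W (SetArr ''coord'' coord_address (Minus (Plus (Reg ''q'') (Const 3)) (band_at ?e1)))
      (\<lambda>t s'. bcost (Less (Reg ''r'') (Reg ''c'')) + t \<le> 24 \<and> reg s' = reg s \<and>
        row_filled i (Suc c) (arr s')) s"
      using a e1[OF lt] Suc lt regs r W_ge
      by (intro wp_SetArr) (simp_all add: cost row_regs_def)
  next
    assume "\<not> bval (Less (Reg ''r'') (Reg ''c'')) s"
    then have lt: "\<not> pos i mod b < c" using regs c by (simp add: row_regs_def)
    show "wp W (SetArr ''coord'' coord_address (Minus (Plus (Reg ''q'') (Const 4)) (band_at ?e2)))
      (\<lambda>t s'. bcost (Less (Reg ''r'') (Reg ''c'')) + t \<le> 24 \<and> reg s' = reg s \<and>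
        row_filled i (Suc c) (arr s')) s"
      using a e2 Suc lt regs r W_ge
      by (intro wp_SetArr) (simp_all add: cost row_regs_def)
  qed
qed

lemma wp_fill_cells:
  assumes i: "i < n" and c: "reg s ''c'' = 0"
    and regs: "row_regs i s" and row: "row_filled i 0 (arr s)"
  shows "wp W fill_cells (\<lambda>t s'. t \<le> 3 + 31 * b \<and> row_regs i s' \<and> reg s' ''c'' = b \<and>
    row_filled i b (arr s')) s"
  unfolding fill_cells_def
proof (rule wp_While[where \<mu> = "\<lambda>s. 3 + 31 * (b - reg s ''c'')" and
      I = "\<lambda>s. row_regs i s \<and> reg s ''c'' \<le> b \<and> row_filled i (reg s ''c'') (arr s)"])
  fix s assume I: "row_regs i s \<and> reg s ''c'' \<le> b \<and> row_filled i (reg s ''c'') (arr s)"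
  show "bfits W (Less (Reg ''c'') (Reg ''b'')) s"
    using I W_ge b_le_n by (simp add: row_regs_def)
  show "bcost (Less (Reg ''c'') (Reg ''b'')) \<le> 3 + 31 * (b - reg s ''c'')" by simp
  assume "bval (Less (Reg ''c'') (Reg ''b'')) s"
  then have c: "reg s ''c'' < b" using I by (simp add: row_regs_def)
  show "wp W (Seq fill_cell (SetReg ''c'' (Plus (Reg ''c'') (Const 1))))
     (\<lambda>t s'. (row_regs i s' \<and> reg s' ''c'' \<le> b \<and> row_filled i (reg s' ''c'') (arr s')) \<and>
        bcost (Less (Reg ''c'') (Reg ''b'')) + t + (3 + 31 * (b - reg s' ''c''))
        \<le> 3 + 31 * (b - reg s ''c'')) s"
  proof (rule wp_Seq, rule wp_mono, rule wp_fill_cell[OF i c refl])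
    fix t :: nat and s' :: state
    assume s': "t \<le> 24 \<and> reg s' = reg s \<and> row_filled i (Suc (reg s ''c'')) (arr s')"
    have "b - reg s ''c'' = Suc (b - Suc (reg s ''c''))" using c by linarith
    then show "wp W (SetReg ''c'' (Plus (Reg ''c'') (Const 1)))
      (\<lambda>(t'::nat) s'. (row_regs i s' \<and> reg s' ''c'' \<le> b \<and> row_filled i (reg s' ''c'') (arr s')) \<and>
        bcost (Less (Reg ''c'') (Reg ''b'')) + (t + t') + (3 + 31 * (b - reg s' ''c''))
        \<le> 3 + 31 * (b - reg s ''c'')) s'"
      using s' I c W_ge b_le_n by (intro wp_SetReg) (simp_all add: row_regs_def)
  qed (use I in auto)
next
  fix t :: nat and s' :: state
  assume "row_regs i s' \<and> reg s' ''c'' \<le> b \<and> row_filled i (reg s' ''c'') (arr s')"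
    and "\<not> bval (Less (Reg ''c'') (Reg ''b'')) s'" "t \<le> 3 + 31 * (b - reg s ''c'')"
  moreover from this have "reg s' ''c'' = b" by (simp add: row_regs_def)
  ultimately show "t \<le> 3 + 31 * b \<and> row_regs i s' \<and> reg s' ''c'' = b \<and> row_filled i b (arr s')"
    using c by simp
qed (use c regs row in simp)

lemma wp_fill_last_cell:
  assumes i: "i < n" and c: "reg s ''c'' = b"
    and regs: "row_regs i s" and row: "row_filled i b (arr s)"
  shows "wp W fill_last_cell (\<lambda>t s'. t \<le> 34 \<and> reg s' = reg s \<and> rows_filled (pos i) (arr s')) s"
proof -
  have p: "1 \<le> pos i" "pos i \<le> n" using pos_range[OF i] by simp_all
  \<comment> \<open>For \<open>b = 0\<close> this is cell \<open>pos i\<close> itself, still 0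
    because only cells below it have been filled.\<close>
  have h: "arr s ''h'' (pos i - b) = (if b = 0 then 0 else shift (pos i - b))"
    using row p unfolding row_filled_def rows_filled_def by (simp add: shift.simps[of 0])
  have shift: "shift (pos i) = arr s ''h'' (pos i - b) + (2 - 2 * band_entry (pos i) b)"
    unfolding h using p by (subst shift.simps) (simp add: band_entry_def)
  have bd: "fits W (band_at (Reg ''b'')) s \<and> aval (band_at (Reg ''b'')) s = band_entry (pos i) b"
    using band_at_correct[OF row i, of "Reg ''b''" b] regs W_ge b_le_n by (simp add: row_regs_def)
  have be: "band_entry (pos i) b \<le> 3" by (simp add: band_entry_def)
  have sh: "shift (pos i) \<le> 2 * n" using shift_le[of "pos i"] p by linarith
  have a: "fits W coord_address s \<and> aval coord_address s = i * (b + 1) + b"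
    using coord_address_correct[OF row i] regs c by (simp add: row_regs_def)
  \<comment> \<open>The address expression reads no array but \<open>inv\<close>, so the preceding
    write to \<open>h\<close> does not change it.\<close>
  have a': "fits W coord_address (s\<lparr>arr := (arr s)(''h'' := x)\<rparr>) = fits W coord_address s"
    "aval coord_address (s\<lparr>arr := (arr s)(''h'' := x)\<rparr>) = aval coord_address s" for x
    by (simp_all add: coord_address_def)
  have cost: "acost coord_address = 6" "\<And>e. acost (band_at e) = 5 + acost e"
    by (simp_all add: coord_address_def band_at_def)
  have long: "(2 * n + 3) * pos i \<le> 2 * (n * n) + 3 * n"
    using mult_le_mono2[OF p(2), of "2 * n + 3"] by (simp add: algebra_simps)
  let ?v = "Plus (Arr ''h'' (Minus (Reg ''p'') (Reg ''b'')))
             (Minus (Const 2) (Times (Const 2) (band_at (Reg ''b''))))"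
  have v: "fits W ?v s" "aval ?v s = shift (pos i)"
    using regs bd be shift sh p b_le_n W_ge by (simp_all add: row_regs_def)
  show ?thesis
    unfolding fill_last_cell_def
  proof (rule wp_Seq, rule wp_SetArr)
    show "fits W (Reg ''p'') s" using regs p W_ge by (simp add: row_regs_def)
    show "fits W ?v s" by (fact v)
    have p_eq: "aval (Reg ''p'') s = pos i" using regs by (simp add: row_regs_def)
    show "wp W (SetArr ''coord'' coord_address
           (Plus (Times (Plus (Times (Const 2) (Reg ''n'')) (Const 3)) (Reg ''p''))
             (Arr ''h'' (Reg ''p''))))
       (\<lambda>t' s'. 1 + acost (Reg ''p'') + acost ?v + t' \<le> 34 \<and> reg s' = reg s \<and>
          rows_filled (pos i) (arr s'))
       (s\<lparr>arr := (arr s)(''h'' := (arr s ''h'')(aval (Reg ''p'') s := aval ?v s))\<rparr>)"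
      unfolding v(2) p_eq
      using a regs p sh long W_ge rows_filled_row[OF i row]
      by (intro wp_SetArr) (simp_all add: a' cost row_regs_def long_coord_def)
  qed
qed

lemma wp_fill_row:
  assumes p: "p < n" "reg s ''p'' = p" "reg s ''r'' = p mod b" "reg s ''q'' = p div b"
    and regs: "reg s ''n'' = n" "reg s ''b'' = b" "reg s ''k'' = b + 1"
    and rows: "rows_filled p (arr s)"
  shows "wp W fill_row (\<lambda>t s'. t \<le> 61 + 31 * b \<and> rows_filled (Suc p) (arr s') \<and>
    reg s' ''n'' = n \<and> reg s' ''b'' = b \<and> reg s' ''k'' = b + 1 \<and>
    reg s' ''p'' = Suc p \<and> reg s' ''r'' = Suc p mod b \<and> reg s' ''q'' = Suc p div b) s"
    (is "wp W _ ?Q s")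
proof -
  obtain i where i: "i < n" "pos i = Suc p" using pos_surj[of "Suc p"] p by auto
  have k: "Suc p * (b + 1) \<le> n * n + n" using mult_k_le[of "Suc p"] p by simp
  show ?thesis
    unfolding fill_row_def
  proof (rule wp_Seq, rule wp_mono, rule wp_next_position[OF p(2,1,3,4) regs(2)])
    fix t1 :: nat and s1 :: state
    assume s1: "t1 \<le> 17 \<and> arr s1 = arr s \<and> (\<forall>x\<in>{''n'', ''b'', ''k''}. reg s1 x = reg s x) \<and>
      reg s1 ''p'' = Suc p \<and> reg s1 ''r'' = Suc p mod b \<and> reg s1 ''q'' = Suc p div b"
    let ?A = "SetArr ''band'' (Times (Reg ''p'') (Reg ''k'')) (Const 3)"
    let ?s2 = "s1\<lparr>arr := (arr s1)(''band'' := (arr s1 ''band'')(pos i * (b + 1) := 3))\<rparr>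
      \<lparr>reg := (reg s1)(''c'' := 0)\<rparr>"
    have s2: "row_regs i ?s2" "row_filled i 0 (arr ?s2)" "reg ?s2 ''c'' = 0"
      using s1 regs i row_filled_0[of i "arr s"] rows by (simp_all add: row_regs_def)
    have "wp W (Seq fill_cells fill_last_cell) (\<lambda>t::nat. ?Q (t1 + 5 + 2 + t)) ?s2"
    proof (rule wp_Seq, rule wp_mono, rule wp_fill_cells[OF i(1) s2(3,1,2)])
      fix t3 :: nat and s3 :: state
      assume s3: "t3 \<le> 3 + 31 * b \<and> row_regs i s3 \<and> reg s3 ''c'' = b \<and> row_filled i b (arr s3)"
      show "wp W fill_last_cell (\<lambda>t::nat. ?Q (t1 + 5 + 2 + (t3 + t))) s3"
        by (rule wp_mono, rule wp_fill_last_cell[OF i(1)]) (use s1 s3 i in \<open>auto simp: row_regs_def\<close>)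
    qed
    then show "wp W (Seq ?A (Seq (SetReg ''c'' (Const 0)) (Seq fill_cells fill_last_cell)))
      (\<lambda>t::nat. ?Q (t1 + t)) s1"
    proof (intro wp_Seq[of _ ?A] wp_SetArr wp_Seq[of _ "SetReg _ _"] wp_SetReg)
      show "fits W (Times (Reg ''p'') (Reg ''k'')) s1"
        using s1 regs k p b_le_n W_ge by (simp del: mult_Suc mult_Suc_right)
    qed (use s1 regs i W_ge in \<open>simp_all add: add.assoc\<close>)
  qed
qed

lemma wp_fill_rows:
  assumes regs: "reg s ''n'' = n" "reg s ''b'' = b"
    and rows: "rows_filled 0 (arr s)"
  shows "wp W fill_rows (\<lambda>t s'. t \<le> 13 + n * (64 + 31 * b) \<and> rows_filled n (arr s') \<and>
    reg s' ''n'' = n \<and> reg s' ''b'' = b \<and> reg s' ''k'' = b + 1) s"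
proof -
  let ?c = "Less (Reg ''p'') (Reg ''n'')"
  define I where "I s \<longleftrightarrow> reg s ''n'' = n \<and> reg s ''b'' = b \<and> reg s ''k'' = b + 1 \<and>
    reg s ''p'' \<le> n \<and> reg s ''r'' = reg s ''p'' mod b \<and> reg s ''q'' = reg s ''p'' div b \<and>
    rows_filled (reg s ''p'') (arr s)" for s :: state
  define \<mu> where "\<mu> s = 3 + (n - reg s ''p'') * (64 + 31 * b)" for s :: state
  have loop: "wp W (While ?c fill_row) (\<lambda>t s'. t \<le> 3 + n * (64 + 31 * b) \<and>
      rows_filled n (arr s') \<and> reg s' ''n'' = n \<and> reg s' ''b'' = b \<and> reg s' ''k'' = b + 1) s"
    if s: "I s" "reg s ''p'' = 0" for s
  proof (rule wp_While[of I _ _ _ _ \<mu>])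
    fix s assume I: "I s"
    show "bfits W ?c s" using I W_ge by (simp add: I_def)
    show "bcost ?c \<le> \<mu> s" by (simp add: \<mu>_def)
    assume "bval ?c s"
    then have p: "reg s ''p'' < n" using I by (simp add: I_def)
    show "wp W fill_row (\<lambda>t s'. I s' \<and> bcost ?c + t + \<mu> s' \<le> \<mu> s) s"
    proof (rule wp_mono, rule wp_fill_row[OF p refl])
      fix t :: nat and s' :: state
      assume s': "t \<le> 61 + 31 * b \<and> rows_filled (Suc (reg s ''p'')) (arr s') \<and>
        reg s' ''n'' = n \<and> reg s' ''b'' = b \<and> reg s' ''k'' = b + 1 \<and>
        reg s' ''p'' = Suc (reg s ''p'') \<and> reg s' ''r'' = Suc (reg s ''p'') mod b \<and>
        reg s' ''q'' = Suc (reg s ''p'') div b"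
      have "n - reg s ''p'' = Suc (n - Suc (reg s ''p''))" using p by linarith
      then show "I s' \<and> bcost ?c + t + \<mu> s' \<le> \<mu> s" using s' p by (simp add: I_def \<mu>_def)
    qed (use I in \<open>auto simp: I_def\<close>)
  next
    fix t :: nat and s' :: state
    assume "I s'" "\<not> bval ?c s'" "t \<le> \<mu> s"
    moreover from this have "reg s' ''p'' = n" by (simp add: I_def)
    ultimately show "t \<le> 3 + n * (64 + 31 * b) \<and>
      rows_filled n (arr s') \<and> reg s' ''n'' = n \<and> reg s' ''b'' = b \<and> reg s' ''k'' = b + 1"
      using s by (simp add: I_def \<mu>_def)
  qed (fact s)
  let ?s = "s\<lparr>reg := (reg s)(''k'' := b + 1, ''p'' := 0, ''q'' := 0, ''r'' := 0)\<rparr>"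
  have "I ?s" "reg ?s ''p'' = 0" using regs rows by (simp_all add: I_def)
  from loop[OF this] show ?thesis
    unfolding fill_rows_def
    by (intro wp_Seq[of _ "SetReg _ _"] wp_SetReg) (use regs b_le_n W_ge in simp_all)
qed

section \<open>Interval lengths and the total running time\<close>

lemma wp_set_lengths:
  assumes regs: "reg s ''n'' = n" "reg s ''b'' = b"
  shows "wp W set_lengths (\<lambda>t s'. t \<le> 20 + 11 * b \<and> (\<forall>c\<le>b. arr s' ''len'' c = len c) \<and>
    arr s' ''coord'' = arr s ''coord'' \<and> reg s' ''k'' = reg s ''k'') s"
proof -
  let ?c = "Less (Reg ''c'') (Reg ''b'')"
  define I where "I s' \<longleftrightarrow> reg s' ''n'' = n \<and> reg s' ''b'' = b \<and> reg s' ''k'' = reg s ''k'' \<and>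
    reg s' ''c'' \<le> b \<and> arr s' ''coord'' = arr s ''coord'' \<and>
    (\<forall>c<reg s' ''c''. arr s' ''len'' c = 2)" for s' :: state
  define \<mu> where "\<mu> s = 3 + (b - reg s ''c'') * 11" for s :: state
  let ?b = "Seq (SetArr ''len'' (Reg ''c'') (Const 2)) (SetReg ''c'' (Plus (Reg ''c'') (Const 1)))"
  have loop: "wp W (While ?c ?b) (\<lambda>t s'. t \<le> 3 + 11 * b \<and> I s' \<and> reg s' ''c'' = b) s"
    if s: "I s" "reg s ''c'' = 0" for s
  proof (rule wp_While[of I _ _ _ _ \<mu>])
    fix s assume I: "I s"
    show "bfits W ?c s" using I W_ge b_le_n by (simp add: I_def)
    show "bcost ?c \<le> \<mu> s" by (simp add: \<mu>_def)
    assume "bval ?c s"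
    then have c: "reg s ''c'' < b" using I by (simp add: I_def)
    have "b - reg s ''c'' = Suc (b - Suc (reg s ''c''))" using c by linarith
    then show "wp W ?b (\<lambda>t s'. I s' \<and> bcost ?c + t + \<mu> s' \<le> \<mu> s) s"
      using I c W_ge b_le_n
      by (intro wp_Seq wp_SetArr wp_SetReg) (simp_all add: I_def \<mu>_def less_Suc_eq)
  next
    fix t :: nat and s' :: state
    assume "I s'" "\<not> bval ?c s'" "t \<le> \<mu> s"
    then show "t \<le> 3 + 11 * b \<and> I s' \<and> reg s' ''c'' = b"
      using s by (simp add: I_def \<mu>_def)
  qed (fact s)
  have long: "(2 * n + 3) * b \<le> 2 * (n * n) + 3 * n"
    using mult_le_mono2[OF b_le_n, of "2 * n + 3"] by (simp add: algebra_simps)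
  have last: "wp W (SetArr ''len'' (Reg ''b'')
      (Plus (Times (Plus (Times (Const 2) (Reg ''n'')) (Const 3)) (Reg ''b'')) (Const 1)))
    (\<lambda>t s'. 2 + (t1 + t) \<le> 20 + 11 * b \<and> (\<forall>c\<le>b. arr s' ''len'' c = len c) \<and>
      arr s' ''coord'' = arr s ''coord'' \<and> reg s' ''k'' = reg s ''k'') s1"
    if s1: "t1 \<le> 3 + 11 * b \<and> I s1 \<and> reg s1 ''c'' = b" for t1 s1
  proof -
    have "((arr s1 ''len'')(b := (2 * n + 3) * b + 1)) c = len c" if "c \<le> b" for c
      using s1 that by (cases "c = b") (simp_all add: I_def len_def)
    then have "\<forall>c\<le>b. ((arr s1 ''len'')(b := (2 * n + 3) * b + 1)) c = len c" by blast
    then show ?thesis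
      using s1 long W_ge b_le_n by (intro wp_SetArr) (simp_all add: I_def)
  qed
  let ?s = "s\<lparr>reg := (reg s)(''c'' := 0)\<rparr>"
  have "I ?s" "reg ?s ''c'' = 0" using regs by (simp_all add: I_def)
  note loop = loop[OF this]
  show ?thesis
    unfolding set_lengths_def
  proof (rule wp_Seq, rule wp_SetReg)
    show "wp W (Seq (While ?c ?b) (SetArr ''len'' (Reg ''b'')
      (Plus (Times (Plus (Times (Const 2) (Reg ''n'')) (Const 3)) (Reg ''b'')) (Const 1))))
      (\<lambda>t' s'. 1 + acost (Const 0) + t' \<le> 20 + 11 * b \<and> (\<forall>c\<le>b. arr s' ''len'' c = len c) \<and>
        arr s' ''coord'' = arr s ''coord'' \<and> reg s' ''k'' = reg s ''k'')
      (s\<lparr>reg := (reg s)(''c'' := aval (Const 0) s)\<rparr>)"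
      unfolding aval.simps by (rule wp_Seq, rule wp_mono, rule loop) (use last in simp)
  qed simp
qed

lemma wp_cubes_program:
  assumes regs: "reg s ''n'' = n" "reg s ''b'' = 0" and inp: "inputs (arr s)"
    and band0: "arr s ''band'' = (\<lambda>_. 0)"
  shows "wp W cubes_program (\<lambda>t s'. t \<le> 500 * time_scale b n \<and> reg s' ''k'' = b + 1 \<and>
    (\<forall>c\<le>b. arr s' ''len'' c = len c) \<and>
    (\<forall>i<n. \<forall>c\<le>b. arr s' ''coord'' (i * (b + 1) + c) = coord (pos i) c)) s"
  unfolding cubes_program_def
proof (rule wp_Seq, rule wp_width_scan[OF regs inp], rule wp_Seq, rule wp_band_scan)
  fix t1 t2 :: nat and s1 s2 :: state
  assume t: "t1 \<le> 7 + n * 29 + off n * 26" "t2 \<le> 7 + n * 29 + off n * 26"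
  assume s2: "reg s2 ''n'' = n" "reg s2 ''b'' = b" "inputs (arr s2)"
    and inv: "\<And>i. i < n \<Longrightarrow> arr s2 ''inv'' (pos i) = i"
    and bd: "\<And>p t. 1 \<le> t \<Longrightarrow> t \<le> b \<Longrightarrow> arr s2 ''band'' (p * (b + 1) + t) = band_entry p t"
  have rows: "rows_filled 0 (arr s2)"
    unfolding rows_filled_def
  proof (intro conjI allI impI)
    fix p show "arr s2 ''h'' p = (if p \<le> 0 then shift p else 0)"
      using s2(3) by (simp add: inputs_def shift.simps[of 0])
  next
    fix i c assume "i < n" "pos i \<le> 0"
    then show "arr s2 ''coord'' (i * (b + 1) + c) = coord (pos i) c"
      using pos_range[of i] by simp
  qed (use inv bd in simp_all)
  show "wp W (Seq fill_rows set_lengths) (\<lambda>t s'. t1 + (t2 + t) \<le> 500 * time_scale b n \<and>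
    reg s' ''k'' = b + 1 \<and> (\<forall>c\<le>b. arr s' ''len'' c = len c) \<and>
    (\<forall>i<n. \<forall>c\<le>b. arr s' ''coord'' (i * (b + 1) + c) = coord (pos i) c)) s2"
  proof (rule wp_Seq, rule wp_mono, rule wp_fill_rows[OF s2(1,2) rows])
    fix t3 :: nat and s3 :: state
    assume s3: "t3 \<le> 13 + n * (64 + 31 * b) \<and> rows_filled n (arr s3) \<and>
      reg s3 ''n'' = n \<and> reg s3 ''b'' = b \<and> reg s3 ''k'' = b + 1"
    \<comment> \<open>Each of 1, \<open>n\<close>, \<open>b * n\<close> and \<open>b\<close> is at
      most \<open>time_scale b n\<close>, and their coefficients 47, 122, 135 and 11 add up to 315;
      500 is a generous round bound.\<close>
    have "t1 + (t2 + (t3 + t4)) \<le> 500 * time_scale b n" if "t4 \<le> 20 + 11 * b" for t4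
    proof -
      have "off n * 26 \<le> 52 * (b * n)" using off_n by simp
      moreover have "n * (64 + 31 * b) = 64 * n + 31 * (b * n)" by (simp add: algebra_simps)
      ultimately have "t1 + (t2 + (t3 + t4)) \<le> 47 + 122 * n + 135 * (b * n) + 11 * b"
        using t s3 that by linarith
      moreover have "1 * 1 \<le> time_scale b n" "1 * n \<le> time_scale b n" "b * n \<le> time_scale b n"
        "b * 1 \<le> time_scale b n"
        unfolding time_scale_def by (intro mult_le_mono max.cobounded1 max.cobounded2)+
      ultimately show ?thesis by linarith
    qed
    then show "wp W set_lengths (\<lambda>t s'. t1 + (t2 + (t3 + t)) \<le> 500 * time_scale b n \<and>
      reg s' ''k'' = b + 1 \<and> (\<forall>c\<le>b. arr s' ''len'' c = len c) \<and>
      (\<forall>i<n. \<forall>c\<le>b. arr s' ''coord'' (i * (b + 1) + c) = coord (pos i) c)) s3"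
      using s3 pos_range
      by (intro wp_mono[OF wp_set_lengths[of s3]]) (auto simp: rows_filled_def)
  qed
qed (use inp band0 in auto)

end


section \<open>Correctness on presented graphs\<close>

lemma kcube_cong: "(\<And>j. j < k \<Longrightarrow> a j = a' j) \<Longrightarrow> kcube k a = kcube k a'"
  unfolding kcube_def by (intro PiE_cong) simp

lemma length_concat_take_Suc:
  "i < length xss \<Longrightarrow> length (concat (take (Suc i) xss)) = length (concat (take i xss)) + length (xss ! i)"
  by (simp add: take_Suc_conv_app_nth)

lemma nth_concat:
  assumes "i < length xss" "k < length (xss ! i)"
  shows "concat xss ! (length (concat (take i xss)) + k) = xss ! i ! k"
    and "length (concat (take i xss)) + k < length (concat xss)"
proof -
  have "concat xss = concat (take i xss) @ xss ! i @ concat (drop (Suc i) xss)"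
    using id_take_nth_drop[OF assms(1)] by (metis concat.simps(2) concat_append)
  then show "concat xss ! (length (concat (take i xss)) + k) = xss ! i ! k"
    and "length (concat (take i xss)) + k < length (concat xss)"
    using assms(2) by (simp_all add: nth_append)
qed

section \<open>From a graph with a linear ordering to positions\<close>

locale ordered_graph =
  fixes V :: "'a set" and E :: "'a set set" and f :: "'a \<Rightarrow> nat"
  assumes graph: "simple_graph V E" and ordering: "linear_ordering V f"
begin

abbreviation "b \<equiv> width E f"

definition nb :: "nat \<Rightarrow> nat \<Rightarrow> bool" where
  "nb p q \<longleftrightarrow> (\<exists>u v. {u, v} \<in> E \<and> f u = p \<and> f v = q)"

lemma edge_vertices:
  assumes "{u, v} \<in> E"
  shows "u \<in> V" "v \<in> V" "u \<noteq> v"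
  using assms graph unfolding simple_graph_def by (auto simp: card_insert_if split: if_splits)

lemma f_range: "v \<in> V \<Longrightarrow> f v \<in> {1..card V}"
  using ordering bij_betwE unfolding linear_ordering_def by blast

lemma f_inj: "inj_on f V"
  using ordering bij_betw_imp_inj_on unfolding linear_ordering_def by blast

lemma nb_f_iff: "u \<in> V \<Longrightarrow> v \<in> V \<Longrightarrow> nb (f u) (f v) \<longleftrightarrow> {u, v} \<in> E"
  unfolding nb_def using edge_vertices f_inj by (metis inj_onD)

lemma finite_edge_lengths: "finite {nat \<bar>int (f u) - int (f v)\<bar> | u v. {u, v} \<in> E}"
proof -
  have "{nat \<bar>int (f u) - int (f v)\<bar> | u v. {u, v} \<in> E}
      \<subseteq> (\<lambda>(u, v). nat \<bar>int (f u) - int (f v)\<bar>) ` (V \<times> V)"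
    using edge_vertices by fast
  moreover have "finite (V \<times> V)" using graph by (simp add: simple_graph_def)
  ultimately show ?thesis using finite_surj by blast
qed

lemma band: "band (card V) b nb"
proof
  show "nb q p" if "nb p q" for p q
    using that unfolding nb_def by (metis insert_commute)
  then have sym: "nb q p" if "nb p q" for p q using that .
  show "p \<in> {1..card V} \<and> q \<in> {1..card V}" if "nb p q" for p q
    using that edge_vertices f_range unfolding nb_def by metis
  show "p \<le> q + b" if "nb p q" for p q
  proof -
    obtain u v where uv: "{u, v} \<in> E" "f u = p" "f v = q" using \<open>nb p q\<close> unfolding nb_def by blast
    then have "nat \<bar>int (f u) - int (f v)\<bar> \<le> b"
      unfolding width_def using finite_edge_lengths by (intro Max_ge) auto
    then show ?thesis using uv by linarith
  qed
  \<comment> \<open>A maximum is a member of its set, so \<open>b\<close> is the inserted 0 or the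
    length of an edge, which by symmetry can be read with its later end first.\<close>
  have "b \<in> insert 0 {nat \<bar>int (f u) - int (f v)\<bar> | u v. {u, v} \<in> E}"
    unfolding width_def using finite_edge_lengths by (intro Max_in) auto
  then consider "b = 0" | u v where "{u, v} \<in> E" "b = nat \<bar>int (f u) - int (f v)\<bar>" by auto
  then show "b = 0 \<or> (\<exists>p. nb (p + b) p)"
  proof cases
    case (2 u v)
    then have "nb (f u) (f v)" unfolding nb_def by blast
    moreover have "f u = f v + b \<or> f v = f u + b" using 2 by linarith
    ultimately show ?thesis using sym by metis
  qed simp
qed

sublocale band "card V" b nb
  by (fact band)

lemma cube_representation_cube: "cube_representation V E (b + 1) (\<lambda>v. cube (f v))"
  unfolding cube_representation_def
proof (intro conjI ballI impI)
  show "\<exists>a. cube (f v) = kcube (b + 1) a" for v unfolding cube_def by blast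
next
  fix u v assume uv: "u \<in> V" "v \<in> V" "u \<noteq> v"
  then have "f u \<noteq> f v" using f_inj by (meson inj_onD)
  then show "{u, v} \<in> E \<longleftrightarrow> cube (f u) \<inter> cube (f v) \<noteq> {}"
    using nb_f_iff nb_iff_cube f_range uv by blast
qed

lemma band_input:
  assumes "adjacency_lists V E vs L" and W: "4 * (card V + 2) * (card V + 2) \<le> W"
  shows "band_input (card V) b nb W
    (array_of (map (\<lambda>i. length (concat (take i L))) [0..<length L + 1]))
    (array_of (concat L)) (array_of (map f vs))"
    (is "band_input _ _ _ _ ?off ?adj ?pos")
proof -
  from assms have vs: "distinct vs" "set vs = V" "length L = length vs"
    unfolding adjacency_lists_def by blast+
  from assms have L: "distinct (L ! i)" "set (L ! i) = {j. j < length vs \<and> {vs ! i, vs ! j} \<in> E}"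
    if "i < length vs" for i using that unfolding adjacency_lists_def by blast+
  have n: "card V = length vs" using distinct_card[OF vs(1)] vs(2) by simp
  have off: "?off i = length (concat (take i L))" if "i \<le> length vs" for i
    using that vs by (simp add: array_of_def nth_append)
  have off_Suc: "?off (Suc i) = ?off i + length (L ! i)" if "i < length vs" for i
    using off that vs length_concat_take_Suc[of i L] by simp
  have pos: "?pos i = f (vs ! i)" if "i < length vs" for i
    using that by (simp add: array_of_def)
  have inV: "vs ! i \<in> V" if "i < length vs" for i using that vs nth_mem by blast
  \<comment> \<open>The neighbours have distinct positions within distance \<open>b\<close>, none of
    them the position of the vertex itself. Summing this bound over the vertices gives
    \<open>off_n\<close>.\<close>
  have deg: "length (L ! i) \<le> 2 * b" if i: "i < length vs" for i
  proof -
    let ?g = "\<lambda>j. f (vs ! j)"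
    let ?S = "{?g i - b..?g i + b} - {?g i}"
    have "inj_on ?g (set (L ! i))"
    proof (rule inj_onI)
      fix j k assume "j \<in> set (L ! i)" "k \<in> set (L ! i)" "?g j = ?g k"
      then show "j = k" using L[OF i] inV f_inj vs(1)
        by (metis (no_types, lifting) inj_onD mem_Collect_eq nth_eq_iff_index_eq)
    qed
    moreover have "?g ` set (L ! i) \<subseteq> ?S"
    proof safe
      fix j assume "j \<in> set (L ! i)"
      then have j: "j < length vs" "{vs ! i, vs ! j} \<in> E" using L[OF i] by auto
      then have nb: "nb (?g i) (?g j)" unfolding nb_def by blast
      show "?g j \<in> {?g i - b..?g i + b}"
        using nb_width[OF nb] nb_width[OF nb_sym[OF nb]] by simp
      assume "?g j = ?g i"
      then show False using edge_vertices[OF j(2)] f_inj by (metis inj_onD)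
    qed
    ultimately have "card (set (L ! i)) \<le> card ?S" by (intro card_inj_on_le) auto
    also have "card ?S = card {?g i - b..?g i + b} - 1" by (intro card_Diff_singleton) auto
    also have "\<dots> \<le> 2 * b" by simp
    finally show ?thesis using L(1)[OF i] distinct_card by metis
  qed
  have "?off i \<le> 2 * b * i" if "i \<le> length vs" for i
    using that
  proof (induction i)
    case 0
    then show ?case using off[of 0] by simp
  next
    case (Suc i)
    then show ?case using off_Suc[of i] deg[of i] by (simp add: add_mult_distrib2)
  qed
  then have off_n: "?off (card V) \<le> 2 * b * card V" using n by simp
  have bij: "bij_betw ?pos {..<card V} {1..card V}"
  proof -
    have "bij_betw (f \<circ> (!) vs) {..<length vs} {1..card V}"
      using bij_betw_nth[OF vs(1) refl, of V] vs(2) ordering bij_betw_trans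
      unfolding linear_ordering_def by blast
    then show ?thesis unfolding n using pos by (subst bij_betw_cong) auto
  qed
  have edge: "nb (?pos i) (?pos j) \<longleftrightarrow> (\<exists>e. ?off i \<le> e \<and> e < ?off (Suc i) \<and> ?adj e = j)"
    if ij: "i < card V" "j < card V" for i j
  proof -
    have i: "i < length vs" and j: "j < length vs" using ij n by simp_all
    have cell: "?adj (?off i + k) = L ! i ! k" if "k < length (L ! i)" for k
      using nth_concat[of i L k] that i off vs by (simp add: array_of_def)
    have "nb (?pos i) (?pos j) \<longleftrightarrow> j \<in> set (L ! i)"
      using nb_f_iff inV i j pos L by simp
    also have "\<dots> \<longleftrightarrow> (\<exists>k<length (L ! i). ?adj (?off i + k) = j)"
      unfolding in_set_conv_nth using cell by auto
    also have "\<dots> \<longleftrightarrow> (\<exists>e. ?off i \<le> e \<and> e < ?off (Suc i) \<and> ?adj e = j)"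
    proof
      assume "\<exists>k<length (L ! i). ?adj (?off i + k) = j"
      then obtain k where k: "k < length (L ! i)" "?adj (?off i + k) = j" by blast
      have "?off i \<le> ?off i + k" "?off i + k < ?off (Suc i)"
        using k(1) off_Suc[OF i] by linarith+
      with k(2) show "\<exists>e. ?off i \<le> e \<and> e < ?off (Suc i) \<and> ?adj e = j" by blast
    next
      assume "\<exists>e. ?off i \<le> e \<and> e < ?off (Suc i) \<and> ?adj e = j"
      then obtain e where e: "?off i \<le> e" "e < ?off (Suc i)" "?adj e = j" by blast
      then have "e - ?off i < length (L ! i)" "?off i + (e - ?off i) = e"
        using off_Suc[OF i] by linarith+
      with e(3) show "\<exists>k<length (L ! i). ?adj (?off i + k) = j" by metis
    qed
    finally show ?thesis .
  qed
  have adj: "?adj e < card V" if "e < ?off (card V)" for e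
  proof -
    have e: "e < length (concat L)" using that off[of "length vs"] n vs by simp
    then have "concat L ! e \<in> set (concat L)" by (rule nth_mem)
    then obtain xs where "xs \<in> set L" "concat L ! e \<in> set xs" by auto
    then show ?thesis using e L(2) vs n unfolding in_set_conv_nth[of xs] by (auto simp: array_of_def)
  qed
  have off_mono: "?off i \<le> ?off (Suc i)" if "i < card V" for i
    using off_Suc[of i] that n by simp
  have off_0: "?off 0 = 0" using off[of 0] by simp
  show ?thesis
    by unfold_locales (fact off_0 off_mono off_n adj bij edge W)+
qed

lemma computes:
  "computes_cube_representation (word_bound 4 (card V)) cubes_program V E f
     (b + 1) (500 * time_scale b (card V))"
  unfolding computes_cube_representation_def
proof (intro allI impI)
  fix vs L assume adj: "adjacency_lists V E vs L"
  let ?n = "card V"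
  \<comment> \<open>The exponent 4 absorbs the factor 4, since \<open>(card V + 2) ^ 2\<close> is at
    least 4 even for the empty graph.\<close>
  have "4 * (?n + 2) * (?n + 2) \<le> word_bound 4 ?n"
  proof -
    have "2 * 2 * ((?n + 2) * (?n + 2)) \<le> (?n + 2) * (?n + 2) * ((?n + 2) * (?n + 2))"
      by (intro mult_le_mono) simp_all
    then show ?thesis by (simp add: word_bound_def eval_nat_numeral algebra_simps)
  qed
  then interpret bi: band_input ?n b nb "word_bound 4 ?n"
    "array_of (map (\<lambda>i. length (concat (take i L))) [0..<length L + 1])"
    "array_of (concat L)" "array_of (map f vs)"
    using band_input[OF adj] by blast
  have n: "?n = length vs" using adj distinct_card unfolding adjacency_lists_def by metis
  let ?s = "input_state vs L f"
  have "wp (word_bound 4 ?n) cubes_program (\<lambda>t s'. t \<le> 500 * time_scale b ?n \<and>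
    reg s' ''k'' = b + 1 \<and> (\<forall>c\<le>b. arr s' ''len'' c = len c) \<and>
    (\<forall>i<?n. \<forall>c\<le>b. arr s' ''coord'' (i * (b + 1) + c) = coord (array_of (map f vs) i) c)) ?s"
  proof (rule bi.wp_cubes_program)
    show "bi.inputs (arr ?s)" unfolding bi.inputs_def by (simp add: input_state_def)
  qed (simp_all add: input_state_def n)
  then obtain t s' where exec: "exec (word_bound 4 ?n) cubes_program ?s t s'"
    and t: "t \<le> 500 * time_scale b ?n" and k: "reg s' ''k'' = b + 1"
    and l: "\<And>c. c \<le> b \<Longrightarrow> arr s' ''len'' c = len c"
    and c: "\<And>i c. i < ?n \<Longrightarrow> c \<le> b \<Longrightarrow>
      arr s' ''coord'' (i * (b + 1) + c) = coord (array_of (map f vs) i) c"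
    unfolding wp_def by blast
  have "outputs_cubes s' vs (b + 1) (\<lambda>v. cube (f v))"
    unfolding outputs_cubes_def
  proof (intro conjI allI impI)
    show "0 < arr s' ''len'' j" if "j < b + 1" for j using l[of j] that len_pos by simp
    show "cube (f (vs ! i)) = kcube (b + 1)
      (\<lambda>j. real (arr s' ''coord'' (i * (b + 1) + j)) / real (arr s' ''len'' j))"
      if "i < length vs" for i
      unfolding cube_def
    proof (rule kcube_cong)
      fix j assume "j < b + 1"
      then have "j \<le> b" by simp
      then show "real (coord (f (vs ! i)) j) / real (len j) =
        real (arr s' ''coord'' (i * (b + 1) + j)) / real (arr s' ''len'' j)"
        using l c[of i j] that n by (simp only: array_of_def length_map if_True nth_map)
    qed
  qed (fact k)
  with exec t cube_representation_cube
  show "\<exists>t s R. exec (word_bound 4 ?n) cubes_program ?s t s \<and> t \<le> 500 * time_scale b ?n \<and>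
    outputs_cubes s vs (b + 1) R \<and> cube_representation V E (b + 1) R" by blast
qed

end

theorem mainTheorem2:
  "\<exists>(p :: com) (C :: nat) (d :: nat). \<forall>(V :: 'a set) (E :: 'a set set) (f :: 'a \<Rightarrow> nat).
     simple_graph V E \<longrightarrow>
       (linear_ordering V f \<longrightarrow>
          computes_cube_representation (word_bound d (card V)) p V E f
            (width E f + 1) (C * time_scale (width E f) (card V))) \<and>
       (bandwidth_ordering V E f \<longrightarrow>
          computes_cube_representation (word_bound d (card V)) p V E f
            (bandwidth V E + 1) (C * time_scale (bandwidth V E) (card V)))"
proof (intro exI allI impI)
  fix V :: "'a set" and E :: "'a set set" and f :: "'a \<Rightarrow> nat"
  assume graph: "simple_graph V E"
  have "computes_cube_representation (word_bound 4 (card V)) cubes_program V E f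
      (width E f + 1) (500 * time_scale (width E f) (card V))" if "linear_ordering V f"
    using ordered_graph.computes[OF ordered_graph.intro[OF graph that]] .
  \<comment> \<open>This instantiates the still schematic witnesses by \<open>cubes_program\<close>,
    500 and 4, independently of the graph. The width of a bandwidth ordering is the bandwidth, so
    the second half is the first one rewritten.\<close>
  then show "(linear_ordering V f \<longrightarrow>
      computes_cube_representation (word_bound 4 (card V)) cubes_program V E f
        (width E f + 1) (500 * time_scale (width E f) (card V))) \<and>
    (bandwidth_ordering V E f \<longrightarrow>
      computes_cube_representation (word_bound 4 (card V)) cubes_program V E f
        (bandwidth V E + 1) (500 * time_scale (bandwidth V E) (card V)))"
    unfolding bandwidth_ordering_def by metis
qed

end
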